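(* As power series (Laurent series where negative powers appear) in $q$, $|q|<1$: (1) \begin{align*} &\sum_{n\ge0}N^{0}(0,4;2n+1)q^n=q^5g(-q^8;q^{16})-q\frac{J_{8}^8J_{32}^2}{J_{4}^4J_{16}^5}+\frac{1}{2}\left(\frac{J_{2}^8J_{8}^2}{J_{1}^4J_{4}^5}+\frac{J_{4}^3}{J_{2}^2} \right),\\ &\sum_{n\ge0}N^{0}(0,4;4n+1)q^n=\frac{J_{2}^4J_{8}^5}{J_{1}^4J_{4}^2J_{16}^2},\qquad \sum_{n\ge0}N^{0}(0,4;4n+3)q^n=q^2g(-q^4;q^8)-\frac{J_{4}^8J_{16}^2}{J_{2}^4J_{8}^5}+2\frac{J_{4}^6}{J_{1}^2J_{2}^3},\\ &\sum_{n\ge0}N^{0}(0,4;8n+1)q^n=\frac{J_{2}^{12}J_{4}}{J_{1}^{10}J_{8}^2},\qquad \sum_{n\ge0}N^{0}(0,4;8n+3)q^n=qg(-q^2;q^4)+2\frac{J_{2}^6J_{4}^5}{J_{1}^8J_{8}^2}-\frac{J_{2}^8J_{8}^2}{J_{1}^4J_{4}^5},\\ &\sum_{n\ge0}N^{0}(0,4;8n+5)q^n=4\frac{J_{4}^9}{J_{1}^6J_{8}^2},\qquad \sum_{n\ge0}N^{0}(0,4;8n+7)q^n=4\frac{J_{2}^8J_{8}^2}{J_{1}^8J_{4}}. \end{align*} (2) \begin{align*} &\sum_{n\ge0}N^{0}(1,4;2n)q^n=-\frac{1}{2}+\frac{1}{2}g(-1;q^4)+\frac{1}{4}\frac{J_{2}^6J_{4}}{J_{1}^4J_{8}^2},\qquad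 \sum_{n\ge0}N^{0}(1,4;4n)q^n=-\frac{1}{2}+\frac{1}{2}g(-1;q^2)+\frac{1}{4}\frac{J_{2}^{15}}{J_{1}^8J_{4}^6},\\ &\sum_{n\ge0}N^{0}(1,4;4n+2)q^n=\frac{J_{2}^3J_{4}^2}{J_{1}^4},\qquad \sum_{n\ge0}N^{0}(1,4;8n)q^n=-\frac{1}{2}+\frac{1}{2}g(-1;q)+\frac{1}{4}\frac{J_{2}^{22}}{J_{1}^{13}J_{4}^8}+4q\frac{J_{4}^8}{J_{1}^5J_{2}^2},\\ &\sum_{n\ge0}N^{0}(1,4;8n+2)q^n=\frac{J_{2}^{16}}{J_{1}^{11}J_{4}^4},\qquad \sum_{n\ge0}N^{0}(1,4;8n+4)q^n=2\frac{J_{2}^{10}}{J_{1}^9},\qquad \sum_{n\ge0}N^{0}(1,4;8n+6)q^n=4\frac{J_{2}^4J_{4}^4}{J_{1}^7}. \end{align*} (3) \begin{align*} &\sum_{n\ge0}N^{0}(2,4;2n+1)q^n=-q^{-1}+q^{-1}g(-1;q^{16})+\frac{1}{2}q^{-1}\frac{J_{8}^{6}J_{16}}{J_{4}^4J_{32}^2}-\frac{1}{2}\frac{J_{4}^3}{J_{2}^2}+\frac{1}{2}\frac{J_{2}^8J_{8}^2}{J_{1}^4J_{4}^5},\\ &\sum_{n\ge0}N^{0}(2,4;4n+1)q^n=2q\frac{J_{2}^4J_{16}^2}{J_{1}^4J_{8}},\qquad \sum_{n\ge0}N^{0}(2,4;4n+3)q^n=-q^{-1}+q^{-1}g(-1;q^8)+\frac{1}{2}q^{-1}\frac{J_{4}^6J_{8}}{J_{2}^4J_{16}^2}+2\frac{J_{4}^6}{J_{1}^2J_{2}^3},\\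 &\sum_{n\ge0}N^{0}(2,4;8n+1)q^n=8q\frac{J_{2}^2J_{4}^3J_{8}^2}{J_{1}^6},\qquad \sum_{n\ge0}N^{0}(2,4;8n+3)q^n=2\frac{J_{2}^6J_{4}^5}{J_{1}^8J_{8}^2},\qquad \sum_{n\ge0}N^{0}(2,4;8n+5)q^n=2\frac{J_{2}^{14}J_{8}^2}{J_{1}^{10}J_{4}^5},\\ &\sum_{n\ge0}N^{0}(2,4;8n+7)q^n=-q^{-1}+q^{-1}g(-1;q^4)+\frac{1}{2}q^{-1}\frac{J_{2}^6J_4}{J_{1}^4J_{8}^2} +4\frac{J_{2}^8J_{8}^2}{J_{1}^8J_{4}}. \end{align*}
   Context: For $|q|<1$: $(a;q)_n=\prod_{k=0}^{n-1}(1-aq^k)$, $(a;q)_\infty=\prod_{k\ge0}(1-aq^k)$, $J_m=(q^m;q^m)_\infty$, and for $x$ not an integer power of $q$, \[g(x;q)=x^{-1}\Big(-1+\sum_{n=0}^{\infty}\frac{q^{n^2}}{(x;q)_{n+1}(q/x;q)_{n}}\Big)\] (expressions such as $g(-q^8;q^{16})$ mean this function with $x=-q^8$ and $q$ replaced by $q^{16}$). An odd Durfee symbol of a positive integer $n$ consists of a nonnegative integer $D$ together with two (possibly empty) non-increasing sequences of odd positive integers $a_1\ge\cdots\ge a_s$ (top row) and $b_1\ge\cdots\ge b_t$ (bottom row), all entries at most $2D+1$, with $n=\sum a_i+\sum b_j+2D^2+2D+1$; its odd rank is $s-t$. $N^{0}(a,M;n)$ is the number of odd Durfee symbols of $n$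 with odd rank congruent to $a$ modulo $M$, and $N^0(a,M;0)=0$. *)

theory Defs
  imports "HOL-Analysis.Analysis" "HOL-Number_Theory.Cong"
begin

definition qpoch :: "complex \<Rightarrow> complex \<Rightarrow> nat \<Rightarrow> complex" where
  "qpoch a q n = (\<Prod>k<n. 1 - a * q ^ k)"

definition qpoch_inf :: "complex \<Rightarrow> complex \<Rightarrow> complex" where
  "qpoch_inf a q = (\<Prod>k. 1 - a * q ^ k)"

definition J :: "nat \<Rightarrow> complex \<Rightarrow> complex" where
  "J m q = qpoch_inf (q ^ m) (q ^ m)"

text \<open>Meaningful for \<open>norm q < 1\<close> and \<open>x\<close> nonzero and not an integer power of \<open>q\<close>.\<close>

definition g :: "complex \<Rightarrow> complex \<Rightarrow> complex" where
  "g x q = inverse x * (- 1 + (\<Sum>n. q ^ (n\<^sup>2) / (qpoch x q (n + 1) * qpoch (q / x) q n)))"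

text \<open>A symbol is a triple of \<open>D\<close>, the top row and the bottom row.\<close>

definition odd_durfee_symbols :: "nat \<Rightarrow> (nat \<times> nat list \<times> nat list) set" where
  "odd_durfee_symbols n =
     {(D, as, bs).
        sorted_wrt (\<ge>) as \<and> sorted_wrt (\<ge>) bs \<and>
        (\<forall>x \<in> set as \<union> set bs. odd x \<and> x \<le> 2 * D + 1) \<and>
        n = sum_list as + sum_list bs + 2 * D\<^sup>2 + 2 * D + 1}"

fun odd_rank :: "nat \<times> nat list \<times> nat list \<Rightarrow> int" where
  "odd_rank (D, as, bs) = int (length as) - int (length bs)"

definition N0 :: "int \<Rightarrow> nat \<Rightarrow> nat \<Rightarrow> nat" where
  "N0 a M n = card {S \<in> odd_durfee_symbols n. [odd_rank S = a] (mod int M)}"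

lemma finite_odd_durfee_symbols: "finite (odd_durfee_symbols n)"
proof -
  define L where "L = {xs. set xs \<subseteq> {..n} \<and> length xs \<le> n}"
  have len: "length xs \<le> sum_list xs" if "\<forall>x\<in>set xs. odd x" for xs :: "nat list"
    using that
  proof (induction xs)
    case (Cons x xs)
    then have "x \<ge> 1" by (auto intro: Suc_leI odd_pos)
    with Cons show ?case by simp
  qed simp
  have "xs \<in> L" if "\<forall>x\<in>set xs. odd x" "sum_list xs \<le> n" for xs
    using len[OF that(1)] that(2) member_le_sum_list[of _ xs]
    unfolding L_def by (auto intro: order_trans)
  then have "odd_durfee_symbols n \<subseteq> {..n} \<times> L \<times> L"
    by (auto simp: odd_durfee_symbols_def)
  moreover have "finite L"
    unfolding L_def by (rule finite_lists_length_le) simp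
  ultimately show ?thesis
    by (meson finite_SigmaI finite_atMost finite_subset)
qed

lemma N0_at_0: "N0 a M 0 = 0"
  by (simp add: N0_def odd_durfee_symbols_def)

end

theory Submission
  imports Defs "HOL-Complex_Analysis.Complex_Analysis"
begin

text \<open>
  The generating function of odd Durfee symbols by odd rank is \<open>q g(z q; q\<^sup>2)\<close>, so summing over the fourth roots of
  unity expresses everything through \<open>\<omega>(\<plusminus>q) = g(\<plusminus>q; q\<^sup>2)\<close> and \<open>g(\<plusminus>\<i>q; q\<^sup>2)\<close>.

  These values are read off from two identities in a free variable \<open>x\<close>, with \<open>\<theta>(x; q) = (x; q)\<^sub>\<infinity> (q/x; q)\<^sub>\<infinity>\<close>. One writes
  \<open>g(x; q)\<close> in terms of \<open>g(- q x\<^sup>\<plusminus>\<^sup>2; q\<^sup>4)\<close> and a quotient of thetas, the other does the same for \<open>g(x; q) + g(- x; q)\<close>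
  and \<open>g(- q x\<^sup>2; q\<^sup>4)\<close>. After multiplication by the thetas all terms are holomorphic for \<open>x \<noteq> 0\<close>, and the functional
  equation \<open>g(q x; q) = - x\<^sup>3 g(x; q) - x - x\<^sup>2\<close> makes their combination invariant under \<open>x \<mapsto> q x\<close> or \<open>x \<mapsto> q\<^sup>2 x\<close>, hence
  constant by the maximum principle; \<open>x = 1\<close> yields the constant.

  Further bisections use \<open>\<phi>(q) = \<phi>(q\<^sup>4) + 2 q \<psi>(q\<^sup>8)\<close> and \<open>\<phi>(q)\<^sup>2 = \<phi>(q\<^sup>2)\<^sup>2 + 4 q \<psi>(q\<^sup>4)\<^sup>2\<close>, since
  \<open>1/J\<^sub>1\<^sup>2\<close> is \<open>\<phi>(q)\<close> times a function of \<open>q\<^sup>2\<close>.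
\<close>

section \<open>Infinite q-products\<close>

lemma norm_power_less_1:
  fixes q :: "'a :: real_normed_div_algebra"
  assumes "norm q < 1" "n > 0"
  shows "norm (q ^ n) < 1"
  using assms by (simp add: norm_power power_less_one_iff)

lemma convergent_prod_qpoch:
  fixes a q :: complex
  assumes "norm q < 1"
  shows "convergent_prod (\<lambda>k. 1 - a * q ^ k)"
proof -
  have "summable (\<lambda>k. norm ((1 - a * q ^ k) - 1))"
    using assms by (simp add: norm_mult norm_power summable_mult summable_geometric)
  then show ?thesis
    using abs_convergent_prod_conv_summable abs_convergent_prod_imp_convergent_prod by blast
qed

lemma qpoch_LIMSEQ:
  assumes "norm q < 1"
  shows "(\<lambda>n. qpoch a q n) \<longlonglongrightarrow> qpoch_inf a q"
  using convergent_prod_LIMSEQ[OF convergent_prod_qpoch[OF assms, of a]]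
  unfolding qpoch_def qpoch_inf_def by (simp only: LIMSEQ_lessThan_iff_atMost)

lemma qpoch_inf_rec:
  assumes "norm q < 1"
  shows "qpoch_inf a q = (1 - a) * qpoch_inf (a * q) q"
proof (rule LIMSEQ_unique)
  have rec: "qpoch a q (Suc n) = (1 - a) * qpoch (a * q) q n" for n
    unfolding qpoch_def by (subst prod.lessThan_Suc_shift) (simp add: mult.assoc)
  show "(\<lambda>n. qpoch a q (Suc n)) \<longlonglongrightarrow> qpoch_inf a q"
    by (rule LIMSEQ_Suc[OF qpoch_LIMSEQ[OF assms]])
  show "(\<lambda>n. qpoch a q (Suc n)) \<longlonglongrightarrow> (1 - a) * qpoch_inf (a * q) q"
    unfolding rec by (intro tendsto_intros qpoch_LIMSEQ assms)
qed

lemma qpoch_inf_split: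
  assumes "norm q < 1"
  shows "qpoch_inf a q = qpoch a q n * qpoch_inf (a * q ^ n) q"
proof (induction n)
  case (Suc n)
  then show ?case
    using qpoch_inf_rec[OF assms, of "a * q ^ n"] by (simp add: qpoch_def mult_ac)
qed (simp add: qpoch_def)

lemma qpoch_inf_0 [simp]: "qpoch_inf 0 q = 1"
  by (simp add: qpoch_inf_def)

lemma qpoch_inf_eq_0_iff:
  assumes "norm q < 1"
  shows "qpoch_inf a q = 0 \<longleftrightarrow> (\<exists>k. a * q ^ k = 1)"
proof
  assume "qpoch_inf a q = 0"
  then obtain k where "1 - a * q ^ k = 0"
    using prodinf_nonzero[OF convergent_prod_qpoch[OF assms]] unfolding qpoch_inf_def by blast
  then have "a * q ^ k = 1"
    by simp
  then show "\<exists>k. a * q ^ k = 1" ..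
next
  assume "\<exists>k. a * q ^ k = 1"
  then obtain k where "a * q ^ k = 1" ..
  then have "qpoch a q (Suc k) = 0"
    by (simp add: qpoch_def)
  then show "qpoch_inf a q = 0"
    using qpoch_inf_split[OF assms, of a "Suc k"] by simp
qed

lemma qpoch_inf_1:
  assumes "norm q < 1"
  shows "qpoch_inf 1 q = 0"
  unfolding qpoch_inf_eq_0_iff[OF assms] by (rule exI[of _ 0]) simp

lemma norm_mult_power_le:
  fixes a q :: "'a :: real_normed_div_algebra"
  assumes "norm q \<le> 1"
  shows "norm (a * q ^ k) \<le> norm a"
  using assms by (simp add: norm_mult norm_power mult_left_le power_le_one)

lemma qpoch_inf_nonzero:
  assumes "norm q < 1" "norm a < 1"
  shows "qpoch_inf a q \<noteq> 0"
proof -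
  have "norm (a * q ^ k) < norm (1 :: complex)" for k
    using norm_mult_power_le[of q a k] assms by simp
  then have "a * q ^ k \<noteq> 1" for k
    by (metis less_irrefl)
  then show ?thesis
    using qpoch_inf_eq_0_iff[OF assms(1)] by simp
qed

lemma norm_qpoch_le:
  assumes "norm q < 1"
  shows "norm (qpoch a q n) \<le> exp (norm a / (1 - norm q))"
proof -
  have "norm (qpoch a q n) \<le> (\<Prod>k<n. 1 + norm a * norm q ^ k)"
    unfolding qpoch_def prod_norm[symmetric]
    by (intro prod_mono) (metis norm_ge_zero norm_mult norm_one norm_power norm_triangle_ineq4)
  also have "\<dots> \<le> exp (\<Sum>k<n. norm a * norm q ^ k)"
    by (rule prod_le_exp_sum) auto
  also have "(\<Sum>k<n. norm a * norm q ^ k) \<le> norm a / (1 - norm q)"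
  proof -
    have "(\<lambda>k. norm a * norm q ^ k) sums (norm a * (1 / (1 - norm q)))"
      using assms by (intro sums_mult geometric_sums) simp
    then show ?thesis
      using sum_le_suminf[of "\<lambda>k. norm a * norm q ^ k" "{..<n}"] by (simp add: sums_iff)
  qed
  finally show ?thesis by simp
qed

lemma norm_qpoch_inf_le:
  assumes "norm q < 1" "norm a \<le> A"
  shows "norm (qpoch_inf a q) \<le> exp (A / (1 - norm q))"
proof -
  have "norm (qpoch_inf a q) \<le> exp (norm a / (1 - norm q))"
    by (rule LIMSEQ_le_const2[OF tendsto_norm[OF qpoch_LIMSEQ[OF assms(1)]]])
      (use norm_qpoch_le[OF assms(1)] in auto)
  also have "\<dots> \<le> exp (A / (1 - norm q))"
    using assms by (simp add: divide_right_mono)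
  finally show ?thesis .
qed

lemma qpoch_inf_holomorphic:
  assumes "norm q < 1"
  shows "(\<lambda>a. qpoch_inf a q) holomorphic_on UNIV"
proof (rule holomorphic_uniform_sequence[where f = "\<lambda>n a. qpoch a q n"])
  fix x :: complex
  have "uniformly_convergent_on (cball x 1) (\<lambda>N a. \<Prod>k<N. 1 - a * q ^ k)"
  proof (rule uniformly_convergent_on_prod')
    have "uniformly_convergent_on (cball x 1) (\<lambda>N a. \<Sum>n<N. norm (a * q ^ n))"
    proof (rule Weierstrass_m_test')
      fix n and a assume "a \<in> cball x 1"
      then have "norm a \<le> norm x + 1"
        using norm_triangle_ineq2[of a x] by (simp add: dist_norm norm_minus_commute)
      then show "norm (norm (a * q ^ n)) \<le> (norm x + 1) * norm q ^ n"
        by (simp add: norm_mult norm_power mult_right_mono)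
    qed (use assms in \<open>auto intro!: summable_mult summable_geometric\<close>)
    then show "uniformly_convergent_on (cball x 1) (\<lambda>N a. \<Sum>n<N. norm (1 - a * q ^ n - 1))"
      by simp
  qed (auto intro!: continuous_intros)
  then have "uniform_limit (cball x 1) (\<lambda>n a. qpoch a q n) (\<lambda>a. lim (\<lambda>n. qpoch a q n)) sequentially"
    unfolding qpoch_def uniformly_convergent_uniform_limit_iff .
  also have "(\<lambda>a. lim (\<lambda>n. qpoch a q n)) = (\<lambda>a. qpoch_inf a q)"
    using qpoch_LIMSEQ[OF assms] limI by blast
  finally show "\<exists>d>0. cball x d \<subseteq> UNIV \<and>
      uniform_limit (cball x d) (\<lambda>n a. qpoch a q n) (\<lambda>a. qpoch_inf a q) sequentially"
    by (intro exI[of _ 1]) auto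
qed (auto simp: qpoch_def intro!: holomorphic_intros)

lemma holomorphic_on_qpoch_inf [holomorphic_intros]:
  assumes "norm q < 1" "f holomorphic_on S"
  shows "(\<lambda>x. qpoch_inf (f x) q) holomorphic_on S"
  using holomorphic_on_compose_gen[OF assms(2) qpoch_inf_holomorphic[OF assms(1)]]
  by (simp add: o_def)

lemma tendsto_qpoch_inf:
  assumes "norm q < 1" "(f \<longlongrightarrow> a) F"
  shows "((\<lambda>x. qpoch_inf (f x) q) \<longlongrightarrow> qpoch_inf a q) F"
proof -
  have "isCont (\<lambda>a. qpoch_inf a q) a"
    using holomorphic_on_imp_continuous_on[OF qpoch_inf_holomorphic[OF assms(1)]]
    by (simp add: continuous_on_eq_continuous_at)
  then show ?thesis
    using assms(2) by (rule isCont_tendsto_compose)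
qed

lemma qpoch_inf_even_odd:
  assumes "norm q < 1"
  shows "qpoch_inf a q = qpoch_inf a (q\<^sup>2) * qpoch_inf (a * q) (q\<^sup>2)"
proof (rule LIMSEQ_unique)
  have q2: "norm (q\<^sup>2) < 1"
    using norm_power_less_1[OF assms] by simp
  have double: "qpoch a q (2 * n) = qpoch a (q\<^sup>2) n * qpoch (a * q) (q\<^sup>2) n" for n
    by (induction n) (simp_all add: qpoch_def power_mult[symmetric] power_add mult_ac)
  show "(\<lambda>n. qpoch a q (2 * n)) \<longlonglongrightarrow> qpoch_inf a q"
    using LIMSEQ_subseq_LIMSEQ[OF qpoch_LIMSEQ[OF assms], of "\<lambda>n. 2 * n"]
    by (simp add: o_def strict_mono_def)
  show "(\<lambda>n. qpoch a q (2 * n)) \<longlonglongrightarrow> qpoch_inf a (q\<^sup>2) * qpoch_inf (a * q) (q\<^sup>2)"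
    unfolding double by (intro tendsto_intros qpoch_LIMSEQ q2)
qed

lemma qpoch_inf_mult_minus:
  assumes "norm q < 1"
  shows "qpoch_inf a q * qpoch_inf (- a) q = qpoch_inf (a\<^sup>2) (q\<^sup>2)"
proof (rule LIMSEQ_unique)
  have q2: "norm (q\<^sup>2) < 1"
    using norm_power_less_1[OF assms] by simp
  have "(1 - a * q ^ k) * (1 - - a * q ^ k) = 1 - a\<^sup>2 * (q\<^sup>2) ^ k" for k
    by (simp add: algebra_simps power2_eq_square power_mult_distrib)
  then have square: "qpoch a q n * qpoch (- a) q n = qpoch (a\<^sup>2) (q\<^sup>2) n" for n
    unfolding qpoch_def prod.distrib[symmetric] by simp
  show "(\<lambda>n. qpoch (a\<^sup>2) (q\<^sup>2) n) \<longlonglongrightarrow> qpoch_inf (a\<^sup>2) (q\<^sup>2)"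
    by (intro qpoch_LIMSEQ q2)
  show "(\<lambda>n. qpoch (a\<^sup>2) (q\<^sup>2) n) \<longlonglongrightarrow> qpoch_inf a q * qpoch_inf (- a) q"
    unfolding square[symmetric] by (intro tendsto_intros qpoch_LIMSEQ assms)
qed

section \<open>Theta functions and the numerator of g\<close>

definition qtheta :: "complex \<Rightarrow> complex \<Rightarrow> complex" where
  "qtheta x q = qpoch_inf x q * qpoch_inf (q / x) q"

definition qtheta_tail :: "complex \<Rightarrow> complex \<Rightarrow> nat \<Rightarrow> nat \<Rightarrow> complex" where
  "qtheta_tail x q m k = qpoch_inf (x * q ^ m) q * qpoch_inf (q ^ k / x) q"

text \<open>\<open>gnum x q\<close> is \<open>g x q * qtheta x q\<close> with the poles at the integer powers of \<open>q\<close> cancelled.\<close>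

definition gnum :: "complex \<Rightarrow> complex \<Rightarrow> complex" where
  "gnum x q = (\<Sum>n. q ^ (n * (n + 1)) * qtheta_tail x q (Suc n) (Suc (Suc n)))"

lemma qtheta_eq_tail: "qtheta x q = qtheta_tail x q 0 1"
  by (simp add: qtheta_def qtheta_tail_def)

lemma qtheta_tail_rec_left:
  assumes "norm q < 1"
  shows "qtheta_tail x q m k = (1 - x * q ^ m) * qtheta_tail x q (Suc m) k"
  using qpoch_inf_rec[OF assms, of "x * q ^ m"] by (simp add: qtheta_tail_def mult_ac)

lemma qtheta_tail_rec_right:
  assumes "norm q < 1"
  shows "qtheta_tail x q m k = (1 - q ^ k / x) * qtheta_tail x q m (Suc k)"
  using qpoch_inf_rec[OF assms, of "q ^ k / x"] by (simp add: qtheta_tail_def mult_ac)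

lemma qtheta_split:
  assumes "norm q < 1"
  shows "qtheta x q = qpoch x q m * qpoch (q / x) q k * qtheta_tail x q m (Suc k)"
  using qpoch_inf_split[OF assms, of x m] qpoch_inf_split[OF assms, of "q / x" k]
  by (simp add: qtheta_def qtheta_tail_def mult_ac)

lemma qtheta_tail_shift:
  assumes "q \<noteq> 0"
  shows "qtheta_tail (q * x) q m (Suc k) = qtheta_tail x q (Suc m) k"
  using assms by (simp add: qtheta_tail_def mult_ac)

lemma qtheta_tail_reflect:
  assumes "q \<noteq> 0"
  shows "qtheta_tail (q / x) q m (Suc k) = qtheta_tail x q k (Suc m)"
  using assms by (simp add: qtheta_tail_def mult_ac)

lemma qtheta_reflect:
  assumes "q \<noteq> 0"
  shows "qtheta (q / x) q = qtheta x q"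
  using qtheta_tail_reflect[OF assms, of x 0 0] by (simp add: qtheta_eq_tail)

lemma gnum_reflect:
  assumes "q \<noteq> 0"
  shows "gnum (q / x) q = gnum x q"
  unfolding gnum_def qtheta_tail_reflect[OF assms] ..

lemma qtheta_factor:
  assumes "norm q < 1"
  shows "qtheta x q = (1 - x) * qtheta_tail x q 1 1"
  using qtheta_tail_rec_left[OF assms, of x 0 1] by (simp add: qtheta_eq_tail)

lemma qtheta_1:
  assumes "norm q < 1"
  shows "qtheta 1 q = 0"
  using qtheta_factor[OF assms, of 1] by simp

lemma qtheta_shift:
  assumes "norm q < 1" "q \<noteq> 0" "x \<noteq> 0"
  shows "qtheta (q * x) q = - qtheta x q / x"
proof -
  have "qtheta (q * x) q = (1 - 1 / x) * qtheta_tail x q 1 1"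
    using qtheta_tail_shift[OF assms(2), of x 0 0] qtheta_tail_rec_right[OF assms(1), of x 1 0]
    by (simp add: qtheta_eq_tail)
  then show ?thesis
    unfolding qtheta_factor[OF assms(1)] using assms(3) by (simp add: field_simps)
qed

lemma qtheta_mult_minus:
  assumes "norm q < 1"
  shows "qtheta x q * qtheta (- x) q = qtheta (x\<^sup>2) (q\<^sup>2)"
  using qpoch_inf_mult_minus[OF assms, of x] qpoch_inf_mult_minus[OF assms, of "q / x"]
  by (simp add: qtheta_def power_divide mult_ac)

lemma norm_qtheta_tail_le:
  assumes "norm q < 1" "norm x \<le> A" "norm (inverse x) \<le> B"
  shows "norm (qtheta_tail x q m k) \<le> exp (A / (1 - norm q)) * exp (B / (1 - norm q))"
  unfolding qtheta_tail_def norm_mult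
proof (intro mult_mono norm_qpoch_inf_le assms)
  show "norm (x * q ^ m) \<le> A"
    using norm_mult_power_le[of q x m] assms by simp
  show "norm (q ^ k / x) \<le> B"
    using norm_mult_power_le[of q "inverse x" k] assms by (simp add: divide_inverse mult.commute)
qed auto

lemma norm_power_mult_le:
  fixes q c :: "'a :: real_normed_div_algebra"
  assumes "norm q < 1" "n \<le> e" "norm c \<le> B"
  shows "norm (q ^ e * c) \<le> B * norm q ^ n"
proof -
  have "norm q ^ e \<le> norm q ^ n"
    using assms by (intro power_decreasing) auto
  then have "norm q ^ e * norm c \<le> norm q ^ n * B"
    using assms by (intro mult_mono) auto
  then show ?thesis
    by (simp add: norm_mult norm_power mult.commute)
qed

lemma summable_norm_power_mult_bounded:
  fixes q :: "'a :: real_normed_div_algebra"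
  assumes "norm q < 1" "\<And>n. n \<le> e n" "\<And>n. norm (c n) \<le> B"
  shows "summable (\<lambda>n. norm (q ^ e n * c n))"
proof (rule summable_comparison_test')
  show "summable (\<lambda>n. B * norm q ^ n)"
    using assms(1) by (intro summable_mult summable_geometric) simp
qed (simp add: norm_power_mult_le[OF assms(1,2,3)])

lemma summable_qtheta_tail:
  assumes "norm q < 1" "\<And>n. n \<le> e n"
  shows "summable (\<lambda>n. q ^ e n * qtheta_tail x q (i n) (j n))"
  by (rule summable_norm_cancel, rule summable_norm_power_mult_bounded[OF assms],
      rule norm_qtheta_tail_le[OF assms(1) order.refl order.refl])

lemma gnum_sums:
  assumes "norm q < 1"
  shows "(\<lambda>n. q ^ (n * (n + 1)) * qtheta_tail x q (Suc n) (Suc (Suc n))) sums gnum x q"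
  unfolding gnum_def by (intro summable_sums summable_qtheta_tail assms) auto

lemma summable_telescope_sums:
  fixes f :: "nat \<Rightarrow> 'a :: real_normed_vector"
  assumes "summable f"
  shows "(\<lambda>n. f n - f (Suc n)) sums f 0"
  using telescope_sums'[OF summable_LIMSEQ_zero[OF assms]] by simp

lemma gnum_shift:
  assumes "norm q < 1" "q \<noteq> 0" "x \<noteq> 0"
  shows "gnum (q * x) q = x\<^sup>2 * gnum x q + (1 + x) * qtheta x q"
proof -
  define U where "U n = q ^ (n * (n + 1)) * qtheta_tail x q (Suc n) (Suc n)" for n
  have step: "(1 - x\<^sup>2) * (U n - U (Suc n)) =
      q ^ (n * (n + 1)) * qtheta_tail (q * x) q (Suc n) (Suc (Suc n))
      - x\<^sup>2 * (q ^ (n * (n + 1)) * qtheta_tail x q (Suc n) (Suc (Suc n)))" for n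
  proof -
    define w y T where "w = q ^ (n * (n + 1))" and "y = q ^ Suc n"
      and "T = qtheta_tail x q (Suc (Suc n)) (Suc (Suc n))"
    have left: "qtheta_tail x q (Suc n) k = (1 - x * y) * qtheta_tail x q (Suc (Suc n)) k" for k
      unfolding y_def by (rule qtheta_tail_rec_left[OF assms(1)])
    have right: "qtheta_tail x q (Suc (Suc n)) (Suc n) = (1 - y / x) * T"
      unfolding y_def T_def by (rule qtheta_tail_rec_right[OF assms(1)])
    have power: "q ^ (Suc n * (Suc n + 1)) = w * y\<^sup>2"
      by (simp add: w_def y_def power_add power2_eq_square)
    show ?thesis
      unfolding U_def qtheta_tail_shift[OF assms(2)] left right power w_def[symmetric] T_def[symmetric]
      using assms by (simp add: field_simps power2_eq_square)
  qed
  have "summable U"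
    unfolding U_def by (intro summable_qtheta_tail assms) auto
  then have "(\<lambda>n. (1 - x\<^sup>2) * (U n - U (Suc n))) sums ((1 - x\<^sup>2) * U 0)"
    by (intro sums_mult summable_telescope_sums)
  moreover have "(\<lambda>n. (1 - x\<^sup>2) * (U n - U (Suc n))) sums (gnum (q * x) q - x\<^sup>2 * gnum x q)"
    unfolding step by (intro sums_diff sums_mult gnum_sums assms)
  moreover have "(1 - x\<^sup>2) * U 0 = (1 + x) * qtheta x q"
    unfolding qtheta_factor[OF assms(1)] U_def by (simp add: algebra_simps power2_eq_square)
  ultimately have "(1 + x) * qtheta x q = gnum (q * x) q - x\<^sup>2 * gnum x q"
    using sums_unique2 by metis
  then show ?thesis
    by (simp add: algebra_simps)
qed

lemma g_eq_gnum:
  assumes "norm q < 1" "x \<noteq> 0" "qtheta x q \<noteq> 0"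
  shows "g x q = gnum x q / qtheta x q"
proof -
  define V S where "V n = q ^ n\<^sup>2 * qtheta_tail x q n (Suc n)"
    and "S n = q ^ n\<^sup>2 * qtheta_tail x q (Suc n) (Suc n)" for n
  have step: "V n - V (Suc n) = S n - x * (q ^ (n * (n + 1)) * qtheta_tail x q (Suc n) (Suc (Suc n)))" for n
  proof -
    define w y T where "w = q ^ n\<^sup>2" and "y = q ^ n" and "T = qtheta_tail x q (Suc n) (Suc (Suc n))"
    have left: "qtheta_tail x q n (Suc n) = (1 - x * y) * qtheta_tail x q (Suc n) (Suc n)"
      unfolding y_def by (rule qtheta_tail_rec_left[OF assms(1)])
    have right: "qtheta_tail x q (Suc n) (Suc n) = (1 - q * y / x) * T"
      unfolding y_def T_def power_Suc[symmetric] by (rule qtheta_tail_rec_right[OF assms(1)])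
    have powers: "q ^ (Suc n)\<^sup>2 = w * (q * y\<^sup>2)" "q ^ (n * (n + 1)) = w * y"
      by (simp_all add: w_def y_def power_add power2_eq_square)
    show ?thesis
      unfolding V_def S_def left right powers w_def[symmetric] T_def[symmetric]
      using assms(2) by (simp add: field_simps power2_eq_square)
  qed
  have "summable V"
    unfolding V_def by (intro summable_qtheta_tail assms) (simp add: power2_eq_square)
  from summable_telescope_sums[OF this] have "(\<lambda>n. V n - V (Suc n)) sums qtheta x q"
    by (simp add: V_def qtheta_eq_tail)
  from sums_add[OF this sums_mult[OF gnum_sums[OF assms(1), of x], of x]]
  have "(\<lambda>n. S n / qtheta x q) sums ((qtheta x q + x * gnum x q) / qtheta x q)"
    unfolding step by (intro sums_divide) simp
  moreover have "S n / qtheta x q = q ^ n\<^sup>2 / (qpoch x q (n + 1) * qpoch (q / x) q n)" for n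
    using qtheta_split[OF assms(1), of x "Suc n" n] assms(3) by (simp add: S_def field_simps)
  ultimately have "(\<Sum>n. q ^ n\<^sup>2 / (qpoch x q (n + 1) * qpoch (q / x) q n)) = 1 + x * gnum x q / qtheta x q"
    using assms(3) by (simp add: sums_iff add_divide_distrib)
  then show ?thesis
    unfolding g_def using assms(2) by simp
qed

lemma g_sums:
  assumes "norm q < 1" "x \<noteq> 0" "qtheta x q \<noteq> 0"
  shows "(\<lambda>n. q ^ (n * (n + 1)) / (qpoch x q (Suc n) * qpoch (q / x) q (Suc n))) sums g x q"
proof -
  have "q ^ (n * (n + 1)) * qtheta_tail x q (Suc n) (Suc (Suc n)) / qtheta x q =
      q ^ (n * (n + 1)) / (qpoch x q (Suc n) * qpoch (q / x) q (Suc n))" for n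
    using qtheta_split[OF assms(1), of x "Suc n" "Suc n"] assms(3) by (simp add: field_simps)
  then show ?thesis
    using sums_divide[OF gnum_sums[OF assms(1), of x], of "qtheta x q"] by (simp add: g_eq_gnum[OF assms])
qed

lemma g_reflect:
  assumes "norm q < 1" "q \<noteq> 0" "x \<noteq> 0" "qtheta x q \<noteq> 0"
  shows "g (q / x) q = g x q"
  using g_eq_gnum[OF assms(1,3,4)] g_eq_gnum[OF assms(1), of "q / x"] assms
    qtheta_reflect[OF assms(2), of x] gnum_reflect[OF assms(2), of x]
  by simp

lemma qtheta_tail_locally_bounded:
  assumes "norm q < 1" "x \<noteq> 0"
  obtains d B where "d > 0" "\<And>y m k. y \<in> ball x d \<Longrightarrow> norm (qtheta_tail y q m k) \<le> B"
proof -
  define d where "d = norm x / 2"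
  define B where "B = exp ((norm x + d) / (1 - norm q)) * exp (inverse d / (1 - norm q))"
  have d: "d > 0"
    using assms by (simp add: d_def)
  have "norm (qtheta_tail y q m k) \<le> B" if "y \<in> ball x d" for y m k
  proof -
    have "norm y \<le> norm x + d" "d \<le> norm y"
      using that norm_triangle_ineq2[of x y] norm_triangle_ineq2[of y x]
      by (auto simp: dist_norm d_def norm_minus_commute)
    moreover from this(2) d have "norm (inverse y) \<le> inverse d"
      unfolding norm_inverse by (intro le_imp_inverse_le)
    ultimately show ?thesis
      unfolding B_def by (intro norm_qtheta_tail_le assms)
  qed
  with d that show ?thesis
    by blast
qed

lemma gnum_holomorphic:
  assumes "norm q < 1"
  shows "(\<lambda>x. gnum x q) holomorphic_on - {0}"
proof -
  define f where "f n x = q ^ (n * (n + 1)) * qtheta_tail x q (Suc n) (Suc (Suc n))" for n x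
  have deriv: "(f n has_field_derivative deriv (f n) x) (at x)" if "x \<in> - {0}" for n x
  proof (rule holomorphic_derivI[OF _ _ that])
    show "f n holomorphic_on - {0}"
      unfolding f_def qtheta_tail_def by (intro holomorphic_intros assms) auto
  qed auto
  have "\<exists>d h. 0 < d \<and> summable h \<and> (\<forall>\<^sub>F n in sequentially. \<forall>y\<in>ball x d \<inter> - {0}. norm (f n y) \<le> h n)"
    if "x \<in> - {0}" for x
  proof -
    from that have "x \<noteq> 0"
      by simp
    then obtain d B where "d > 0" and B: "\<And>y m k. y \<in> ball x d \<Longrightarrow> norm (qtheta_tail y q m k) \<le> B"
      using qtheta_tail_locally_bounded[OF assms] by blast
    have "norm (f n y) \<le> B * norm q ^ n" if "y \<in> ball x d" for n y
      unfolding f_def by (intro norm_power_mult_le B assms that) simp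
    moreover have "summable (\<lambda>n. B * norm q ^ n)"
      using assms by (intro summable_mult summable_geometric) simp
    ultimately show ?thesis
      using \<open>d > 0\<close> by (intro exI[of _ d] exI[of _ "\<lambda>n. B * norm q ^ n"]) auto
  qed
  from series_and_derivative_comparison_local[OF _ deriv this]
  obtain G G' where G: "\<And>x. x \<in> - {0} \<Longrightarrow> (\<lambda>n. f n x) sums G x \<and> (G has_field_derivative G' x) (at x)"
    by auto
  then have "G x = gnum x q" if "x \<in> - {0}" for x
    using that gnum_sums[OF assms, of x] sums_unique2 unfolding f_def by blast
  moreover have "G holomorphic_on - {0}"
    unfolding holomorphic_on_def field_differentiable_def
    using G has_field_derivative_at_within by blast
  ultimately show ?thesis
    using holomorphic_transform[of G "- {0}" "\<lambda>x. gnum x q"] by simp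
qed

lemma holomorphic_on_gnum [holomorphic_intros]:
  assumes "norm q < 1" "f holomorphic_on S" "\<And>x. x \<in> S \<Longrightarrow> f x \<noteq> 0"
  shows "(\<lambda>x. gnum (f x) q) holomorphic_on S"
proof -
  have "f ` S \<subseteq> - {0}"
    using assms(3) by auto
  then show ?thesis
    using holomorphic_on_compose_gen[OF assms(2) gnum_holomorphic[OF assms(1)]] by (simp add: o_def)
qed

lemma holomorphic_on_qtheta [holomorphic_intros]:
  assumes "norm q < 1" "f holomorphic_on S" "\<And>x. x \<in> S \<Longrightarrow> f x \<noteq> 0"
  shows "(\<lambda>x. qtheta (f x) q) holomorphic_on S"
  unfolding qtheta_def by (intro holomorphic_intros assms)

text \<open>The terms of Cauchy's identity \<open>\<Sum>n. q\<^bsup>n\<^sup>2\<^esup> z\<^sup>n / ((q; q)\<^sub>n (z q; q)\<^sub>n) = 1 / (z q; q)\<^sub>\<infinity>\<close>, multiplied by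
  \<open>(q; q)\<^sub>\<infinity> (z q; q)\<^sub>\<infinity>\<close>: their sum is invariant under \<open>z \<mapsto> z q\<close>, so one may let \<open>z\<close> tend to 0 along powers of \<open>q\<close>.\<close>

definition Cauchy_term :: "complex \<Rightarrow> complex \<Rightarrow> nat \<Rightarrow> complex" where
  "Cauchy_term z q n = q ^ n\<^sup>2 * (z ^ n * (qpoch_inf (z * q ^ Suc n) q * qpoch_inf (q ^ Suc n) q))"

lemma norm_Cauchy_factor_le:
  assumes "norm q < 1" "norm z \<le> 1"
  shows "norm (z ^ n * (qpoch_inf (z * q ^ m) q * qpoch_inf (q ^ k) q))
    \<le> exp (1 / (1 - norm q)) * exp (1 / (1 - norm q))"
proof -
  have "norm (qpoch_inf (z * q ^ m) q) \<le> exp (1 / (1 - norm q))"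
    using norm_mult_power_le[of q z m] assms by (intro norm_qpoch_inf_le) auto
  moreover have "norm (qpoch_inf (q ^ k) q) \<le> exp (1 / (1 - norm q))"
    using norm_mult_power_le[of q 1 k] assms by (intro norm_qpoch_inf_le) auto
  ultimately have "norm z ^ n * (norm (qpoch_inf (z * q ^ m) q) * norm (qpoch_inf (q ^ k) q))
      \<le> 1 * (exp (1 / (1 - norm q)) * exp (1 / (1 - norm q)))"
    using assms by (intro mult_mono power_le_one) auto
  then show ?thesis
    by (simp add: norm_mult norm_power)
qed

lemma summable_Cauchy_term:
  assumes "norm q < 1" "norm z \<le> 1"
  shows "summable (Cauchy_term z q)"
  unfolding Cauchy_term_def
  by (rule summable_norm_cancel, rule summable_norm_power_mult_bounded[OF assms(1)])
    (auto simp: power2_eq_square simp del: power_Suc intro!: norm_Cauchy_factor_le assms)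

lemma suminf_Cauchy_term_shift:
  assumes "norm q < 1" "norm z \<le> 1"
  shows "suminf (Cauchy_term (z * q) q) = suminf (Cauchy_term z q)"
proof -
  define V where "V n = q ^ n\<^sup>2 * (z ^ n * (qpoch_inf (z * q ^ Suc n) q * qpoch_inf (q ^ n) q))" for n
  have "V n - V (Suc n) = Cauchy_term z q n - Cauchy_term (z * q) q n" for n
  proof -
    define y a b where "y = q ^ n" and "a = qpoch_inf (z * q ^ Suc (Suc n)) q"
      and "b = qpoch_inf (q ^ Suc n) q"
    have recs: "qpoch_inf (z * q ^ Suc n) q = (1 - z * (q * y)) * a" "qpoch_inf (q ^ n) q = (1 - y) * b"
      using qpoch_inf_rec[OF assms(1), of "z * q ^ Suc n"] qpoch_inf_rec[OF assms(1), of "q ^ n"]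
      by (simp_all add: y_def a_def b_def mult_ac)
    have powers: "q ^ (Suc n)\<^sup>2 = q ^ n\<^sup>2 * (q * y\<^sup>2)" "(z * q) ^ n = z ^ n * y"
      "z * q * q ^ Suc n = z * q ^ Suc (Suc n)"
      by (simp_all add: y_def power_add power2_eq_square power_mult_distrib mult_ac)
    show ?thesis
      unfolding V_def Cauchy_term_def recs powers a_def[symmetric] b_def[symmetric]
      by (simp add: algebra_simps power2_eq_square)
  qed
  moreover have "summable V"
    unfolding V_def
    by (rule summable_norm_cancel, rule summable_norm_power_mult_bounded[OF assms(1)])
      (auto simp: power2_eq_square simp del: power_Suc intro!: norm_Cauchy_factor_le assms)
  moreover have "V 0 = 0"
    by (simp add: V_def qpoch_inf_1[OF assms(1)])
  ultimately have "(\<lambda>n. Cauchy_term z q n - Cauchy_term (z * q) q n) sums 0"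
    using summable_telescope_sums[of V] by simp
  moreover have "norm (z * q) \<le> 1"
    using assms by (simp add: norm_mult mult_le_one)
  ultimately show ?thesis
    using suminf_diff[OF summable_Cauchy_term[OF assms] summable_Cauchy_term[OF assms(1)], of "z * q"]
    by (simp add: sums_iff)
qed

lemma Cauchy_identity:
  assumes "norm q < 1" "norm z \<le> 1"
  shows "Cauchy_term z q sums qpoch_inf q q"
proof -
  define B where "B = exp (1 / (1 - norm q)) * exp (1 / (1 - norm q))"
  have norm_le: "norm (z * q ^ k) \<le> 1" for k
    using norm_mult_power_le[of q z k] assms by simp
  have invariant: "suminf (Cauchy_term (z * q ^ k) q) = suminf (Cauchy_term z q)" for k
  proof (induction k)
    case (Suc k)
    then show ?case
      using suminf_Cauchy_term_shift[OF assms(1) norm_le] by (simp add: mult_ac)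
  qed simp
  have "(\<lambda>k. z * q ^ k) \<longlonglongrightarrow> 0"
    using LIMSEQ_power_zero[OF assms(1)] by (rule tendsto_mult_right_zero)
  then have zq: "(\<lambda>k. (z * q ^ k) * q ^ Suc n) \<longlonglongrightarrow> 0" for n
    by (rule tendsto_mult_left_zero)
  have "(\<lambda>k. Cauchy_term (z * q ^ k) q n) \<longlonglongrightarrow> q ^ n\<^sup>2 * (0 ^ n * (qpoch_inf 0 q * qpoch_inf (q ^ Suc n) q))" for n
    unfolding Cauchy_term_def
    by (intro tendsto_intros tendsto_qpoch_inf assms(1) zq \<open>(\<lambda>k. z * q ^ k) \<longlonglongrightarrow> 0\<close>)
  moreover have "norm (Cauchy_term (z * q ^ k) q n) \<le> B * norm q ^ n" for n k
    unfolding Cauchy_term_def B_def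
    by (intro norm_power_mult_le norm_Cauchy_factor_le norm_le assms) (simp add: power2_eq_square)
  moreover have "summable (\<lambda>n. B * norm q ^ n)"
    using assms by (intro summable_mult summable_geometric) simp
  ultimately have "(\<lambda>k. suminf (Cauchy_term (z * q ^ k) q)) \<longlonglongrightarrow>
      (\<Sum>n. q ^ n\<^sup>2 * (0 ^ n * (qpoch_inf 0 q * qpoch_inf (q ^ Suc n) q)))"
    by (intro tannerys_theorem[where M = "\<lambda>n. B * norm q ^ n", THEN conjunct2, THEN conjunct2])
      (auto intro: always_eventually)
  moreover have "(\<Sum>n. q ^ n\<^sup>2 * (0 ^ n * (qpoch_inf 0 q * qpoch_inf (q ^ Suc n) q))) = qpoch_inf q q"
    by (subst suminf_finite[of "{0}"]) auto
  ultimately have "suminf (Cauchy_term z q) = qpoch_inf q q"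
    unfolding invariant by (simp add: LIMSEQ_const_iff)
  then show ?thesis
    using summable_sums[OF summable_Cauchy_term[OF assms]] by simp
qed

lemma gnum_1:
  assumes "norm q < 1"
  shows "gnum 1 q = qpoch_inf q q"
proof -
  have "q ^ (n * (n + 1)) * qtheta_tail 1 q (Suc n) (Suc (Suc n)) = Cauchy_term q q n" for n
    by (simp add: Cauchy_term_def qtheta_tail_def power_add power2_eq_square mult_ac)
  then show ?thesis
    using sums_unique2[OF gnum_sums[OF assms, of 1]] Cauchy_identity[OF assms, of q] assms by simp
qed

section \<open>Functions invariant under multiplication by q\<close>

definition qannulus :: "complex \<Rightarrow> complex set" where
  "qannulus q = {x. norm q < norm x \<and> norm (q * x) < 1}"

lemma open_qannulus: "open (qannulus q)"
  unfolding qannulus_def by (intro open_Collect_conj open_Collect_less continuous_intros)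

lemma connected_qannulus:
  assumes "q \<noteq> 0"
  shows "connected (qannulus q)"
proof -
  have "qannulus q = {x. norm q < norm (x - 0) \<and> norm (x - 0) < 1 / norm q}"
    using assms by (auto simp: qannulus_def norm_mult field_simps)
  then show ?thesis
    using connected_annulus(1)[where a = "0 :: complex" and ?r1.0 = "norm q" and ?r2.0 = "1 / norm q"] by simp
qed

lemma qannulus_nonzero: "x \<in> qannulus q \<Longrightarrow> x \<noteq> 0"
  by (auto simp: qannulus_def)

lemma norm_1_in_qannulus:
  assumes "norm q < 1" "norm x = 1"
  shows "x \<in> qannulus q"
  using assms by (simp add: qannulus_def norm_mult)

text \<open>Compact, and up to one multiplication or division by \<open>q\<close> it contains every point of the annulus; so a function
  invariant under \<open>x \<mapsto> q x\<close> attains its maximum modulus there.\<close>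

definition qannulus_core :: "complex \<Rightarrow> complex set" where
  "qannulus_core q = {x. norm q \<le> (norm x)\<^sup>2 \<and> norm q * (norm x)\<^sup>2 \<le> 1}"

lemma compact_qannulus_core:
  assumes "q \<noteq> 0"
  shows "compact (qannulus_core q)"
proof -
  have "closed (qannulus_core q)"
    unfolding qannulus_core_def by (intro closed_Collect_conj closed_Collect_le continuous_intros)
  moreover have "norm x \<le> 1 + 1 / norm q" if "x \<in> qannulus_core q" for x
  proof -
    have "norm x \<le> 1 + (norm x)\<^sup>2"
      using zero_le_power2[of "norm x - 1"] by (simp add: power2_diff) (use norm_ge_zero[of x] in linarith)
    also have "(norm x)\<^sup>2 \<le> 1 / norm q"
      using that assms by (simp add: qannulus_core_def field_simps)
    finally show ?thesis by simp
  qed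
  ultimately show ?thesis
    by (metis compact_eq_bounded_closed boundedI)
qed

lemma qannulus_core_subset:
  assumes "norm q < 1" "q \<noteq> 0"
  shows "qannulus_core q \<subseteq> qannulus q"
proof
  fix x assume x: "x \<in> qannulus_core q"
  have "(norm q)\<^sup>2 < norm q"
    using assms by (simp add: power2_eq_square)
  with x have "(norm q)\<^sup>2 < (norm x)\<^sup>2"
    by (simp add: qannulus_core_def)
  then have "norm q < norm x"
    by (rule power2_less_imp_less) simp
  have "(norm (q * x))\<^sup>2 = norm q * (norm q * (norm x)\<^sup>2)"
    by (simp add: norm_mult power2_eq_square)
  also have "\<dots> \<le> norm q * 1"
    using x by (intro mult_left_mono) (auto simp: qannulus_core_def)
  also have "\<dots> < 1\<^sup>2"
    using assms by simp
  finally have "norm (q * x) < 1"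
    by (rule power2_less_imp_less) simp
  with \<open>norm q < norm x\<close> show "x \<in> qannulus q"
    by (simp add: qannulus_def)
qed

lemma qannulus_core_representative:
  assumes "norm q < 1" "q \<noteq> 0" "x \<in> qannulus q"
  obtains w where "w \<in> qannulus_core q" "w = x \<or> w = q * x \<or> q * w = x"
proof -
  consider (core) "x \<in> qannulus_core q" | (inside) "(norm x)\<^sup>2 < norm q" | (outside) "1 < norm q * (norm x)\<^sup>2"
    unfolding qannulus_core_def by fastforce
  then show ?thesis
  proof cases
    case inside
    have "norm q < norm x"
      using assms by (simp add: qannulus_def)
    then have "(norm q)\<^sup>2 < (norm x)\<^sup>2"
      by (rule power_strict_mono) auto
    moreover have "norm q * (norm q)\<^sup>2 \<le> (norm q)\<^sup>2"
      using assms by (simp add: mult_left_le_one_le)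
    ultimately have "norm q * (norm q)\<^sup>2 \<le> (norm x)\<^sup>2"
      by simp
    moreover have "norm q * (norm x)\<^sup>2 \<le> (norm q)\<^sup>2"
      using inside by (simp add: power2_eq_square mult_left_mono)
    ultimately have "x / q \<in> qannulus_core q"
      using assms by (simp add: qannulus_core_def norm_divide power_divide field_simps)
    then show ?thesis
      using that[of "x / q"] assms by simp
  next
    case outside
    have "(norm (q * x))\<^sup>2 < 1"
      using assms by (simp add: qannulus_def power_less_one_iff abs_square_less_1)
    then have "norm q * (norm (q * x))\<^sup>2 \<le> 1"
      using assms by (intro mult_le_one) auto
    moreover have "norm q * 1 \<le> norm q * (norm q * (norm x)\<^sup>2)"
      using outside by (intro mult_left_mono) auto
    ultimately have "q * x \<in> qannulus_core q"
      by (simp add: qannulus_core_def norm_mult power_mult_distrib power2_eq_square mult_ac)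
    then show ?thesis
      using that[of "q * x"] by simp
  qed (use that in blast)
qed

lemma q_periodic_constant_on_qannulus:
  assumes q: "norm q < 1" "q \<noteq> 0"
    and hol: "f holomorphic_on qannulus q"
    and periodic: "\<And>x. x \<in> qannulus q \<Longrightarrow> q * x \<in> qannulus q \<Longrightarrow> f (q * x) = f x"
  shows "f constant_on qannulus q"
proof -
  note core_subset = qannulus_core_subset[OF q]
  have "1 \<in> qannulus_core q"
    using q by (simp add: qannulus_core_def)
  moreover have "continuous_on (qannulus_core q) (\<lambda>x. norm (f x))"
    using hol core_subset
    by (intro continuous_on_norm) (meson continuous_on_subset holomorphic_on_imp_continuous_on)
  ultimately obtain w where w: "w \<in> qannulus_core q" "\<And>z. z \<in> qannulus_core q \<Longrightarrow> norm (f z) \<le> norm (f w)"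
    using continuous_attains_sup[OF compact_qannulus_core[OF q(2)]] by blast
  have "norm (f x) \<le> norm (f w)" if x: "x \<in> qannulus q" for x
  proof -
    obtain v where v: "v \<in> qannulus_core q" "v = x \<or> v = q * x \<or> q * v = x"
      using qannulus_core_representative[OF q x] .
    then have "f x = f v"
      using periodic[of x] periodic[of v] core_subset x by auto
    then show ?thesis
      using w(2)[OF v(1)] by simp
  qed
  then show ?thesis
    using w(1) core_subset open_qannulus connected_qannulus[OF q(2)]
    by (intro maximum_modulus_principle[OF hol, of "qannulus q" w]) auto
qed

lemma holomorphic_eq_from_qannulus:
  assumes "norm q < 1" "f holomorphic_on - {0}" "h holomorphic_on - {0}"
    and "\<And>x. x \<in> qannulus q \<Longrightarrow> f x = h x" and "x \<noteq> 0"
  shows "f x = h x"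
proof (rule analytic_continuation_open[OF open_qannulus[of q] _ _ _ _ assms(2,3,4)])
  show "qannulus q \<noteq> {}"
    using norm_1_in_qannulus[OF assms(1), of 1] by auto
  show "connected (- {0 :: complex})"
    by (rule connected_punctured_universe) simp
qed (use assms qannulus_nonzero in auto)

lemma q_periodic_constant:
  assumes q: "norm q < 1" "q \<noteq> 0"
    and hol: "f holomorphic_on - {0}"
    and periodic: "\<And>x. x \<noteq> 0 \<Longrightarrow> f (q * x) = f x"
    and "x \<noteq> 0"
  shows "f x = f 1"
proof (rule holomorphic_eq_from_qannulus[OF q(1) hol _ _ \<open>x \<noteq> 0\<close>])
  have "f constant_on qannulus q"
    using q hol periodic qannulus_nonzero
    by (intro q_periodic_constant_on_qannulus) (auto intro: holomorphic_on_subset)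
  then show "f y = f 1" if "y \<in> qannulus q" for y
    using that norm_1_in_qannulus[OF q(1), of 1] unfolding constant_on_def by auto
qed auto

lemma qtheta_tail_nonzero_on_qannulus:
  assumes "norm q < 1" "x \<in> qannulus q"
  shows "qtheta_tail x q 1 1 \<noteq> 0"
proof -
  have "norm (x * q) < 1" "norm (q / x) < 1"
    using assms qannulus_nonzero[OF assms(2)] by (auto simp: qannulus_def norm_divide mult.commute)
  then show ?thesis
    using qpoch_inf_nonzero[OF assms(1)] by (simp add: qtheta_tail_def)
qed

lemma qtheta_nonzero_on_qannulus:
  assumes "norm q < 1" "x \<in> qannulus q" "x \<noteq> 1"
  shows "qtheta x q \<noteq> 0"
  using qtheta_tail_nonzero_on_qannulus[OF assms(1,2)] assms(3) by (simp add: qtheta_factor[OF assms(1)])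

lemma holomorphic_multiple_of_qtheta:
  assumes q: "norm q < 1" and hol: "R holomorphic_on qannulus q" and "R 1 = 0"
  obtains h where "h holomorphic_on qannulus q" "\<And>x. x \<in> qannulus q \<Longrightarrow> R x = h x * qtheta x q"
proof
  define D where "D x = (if x = 1 then deriv R 1 else (R x - R 1) / (x - 1))" for x
  show "(\<lambda>x. - D x / qtheta_tail x q 1 1) holomorphic_on qannulus q"
    unfolding D_def
    by (intro holomorphic_on_divide holomorphic_on_minus pole_lemma_open hol open_qannulus
        qtheta_tail_nonzero_on_qannulus q)
      (auto simp: qtheta_tail_def dest: qannulus_nonzero intro!: holomorphic_intros q)
  show "R x = - D x / qtheta_tail x q 1 1 * qtheta x q" if "x \<in> qannulus q" for x
    using qtheta_tail_nonzero_on_qannulus[OF q that] \<open>R 1 = 0\<close>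
    by (simp add: D_def qtheta_factor[OF q] divide_simps) (simp add: algebra_simps)
qed

lemma qtheta_unique:
  assumes q: "norm q < 1" "q \<noteq> 0"
    and hol: "R holomorphic_on - {0}"
    and shift: "\<And>x. x \<noteq> 0 \<Longrightarrow> R (q * x) = - R x / x"
    and "R 1 = 0" "x \<noteq> 0"
  shows "R x * qtheta (-1) q = R (-1) * qtheta x q"
proof (rule holomorphic_eq_from_qannulus[OF q(1) _ _ _ \<open>x \<noteq> 0\<close>])
  have "R holomorphic_on qannulus q"
    using hol by (rule holomorphic_on_subset) (auto dest: qannulus_nonzero)
  from holomorphic_multiple_of_qtheta[where R = R, OF q(1) this \<open>R 1 = 0\<close>]
  obtain h where h: "h holomorphic_on qannulus q" "\<And>x. x \<in> qannulus q \<Longrightarrow> R x = h x * qtheta x q"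
    by blast
  have "h (q * x) = h x" if x: "x \<in> qannulus q" "q * x \<in> qannulus q" for x
  proof -
    have "q * x \<noteq> 1" "x \<noteq> 0"
      using x qannulus_nonzero by (auto simp: qannulus_def)
    then have "qtheta (q * x) q \<noteq> 0"
      using qtheta_nonzero_on_qannulus[OF q(1) x(2)] by simp
    moreover have "h x * qtheta (q * x) q = h (q * x) * qtheta (q * x) q"
      using h(2)[OF x(1)] h(2)[OF x(2)] shift[OF \<open>x \<noteq> 0\<close>] by (simp add: qtheta_shift[OF q \<open>x \<noteq> 0\<close>])
    ultimately show ?thesis
      by simp
  qed
  then have "h constant_on qannulus q"
    by (rule q_periodic_constant_on_qannulus[OF q h(1)])
  then obtain c where "\<And>x. x \<in> qannulus q \<Longrightarrow> h x = c"
    unfolding constant_on_def by blast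
  then show "R y * qtheta (-1) q = R (-1) * qtheta y q" if "y \<in> qannulus q" for y
    using h(2) that norm_1_in_qannulus[OF q(1), of "-1"] by simp
qed (auto intro!: holomorphic_intros hol q)

section \<open>Theta functions as products of the J\<close>

lemma J_nonzero [simp]:
  assumes "norm q < 1" "m > 0"
  shows "J m q \<noteq> 0"
  unfolding J_def using norm_power_less_1[OF assms] by (intro qpoch_inf_nonzero)

lemma J_power: "J m (q ^ k) = J (m * k) q"
  by (simp add: J_def mult.commute flip: power_mult)

lemma J_minus_even:
  assumes "even m"
  shows "J m (- q) = J m q"
  using assms by (simp add: J_def)

lemma qpoch_inf_minus_J:
  assumes "norm q < 1"
  shows "qpoch_inf (- q) q = J 2 q / J 1 q"
  using qpoch_inf_mult_minus[OF assms, of q] J_nonzero[OF assms, of 1]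
  by (simp add: J_def field_simps)

lemma qpoch_inf_odd_J:
  assumes "norm q < 1"
  shows "qpoch_inf q (q\<^sup>2) = J 1 q / J 2 q"
  using qpoch_inf_even_odd[OF assms, of q] J_nonzero[OF assms, of 2]
  by (simp add: J_def field_simps power2_eq_square)

lemma qpoch_inf_minus_odd_J:
  assumes "norm q < 1"
  shows "qpoch_inf (- q) (q\<^sup>2) = J 2 q ^ 2 / (J 1 q * J 4 q)"
proof -
  have "norm (q\<^sup>2) < 1"
    using norm_power_less_1[OF assms] by simp
  then have "qpoch_inf (- (q\<^sup>2)) (q\<^sup>2) = J 4 q / J 2 q"
    using qpoch_inf_minus_J[of "q\<^sup>2"] by (simp add: J_power)
  then show ?thesis
    using qpoch_inf_even_odd[OF assms, of "- q"] qpoch_inf_minus_J[OF assms] assms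
    by (simp add: field_simps power2_eq_square)
qed

lemma J_1_minus:
  assumes "norm q < 1"
  shows "J 1 (- q) = J 2 q ^ 3 / (J 1 q * J 4 q)"
proof -
  have "J 1 (- q) / J 2 q = J 2 q ^ 2 / (J 1 q * J 4 q)"
    using qpoch_inf_odd_J[of "- q"] qpoch_inf_minus_odd_J[OF assms] assms by (simp add: J_minus_even)
  then have "J 1 (- q) = J 2 q ^ 2 / (J 1 q * J 4 q) * J 2 q"
    using assms by (metis J_nonzero nonzero_eq_divide_eq zero_less_numeral)
  then show ?thesis
    by (simp add: power_numeral_reduce mult_ac)
qed

text \<open>The product forms of Ramanujan's \<open>\<phi>(q) = \<Sum>n. q\<^bsup>n\<^sup>2\<^esup>\<close>, summed over all integers, and
  \<open>\<psi>(q) = \<Sum>n. q\<^bsup>n(n+1)/2\<^esup>\<close>, summed over \<open>n \<ge> 0\<close>.\<close>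

definition theta_phi :: "complex \<Rightarrow> complex" where
  "theta_phi q = J 2 q ^ 5 / (J 1 q ^ 2 * J 4 q ^ 2)"

definition theta_psi :: "complex \<Rightarrow> complex" where
  "theta_psi q = J 2 q ^ 2 / J 1 q"

lemma theta_phi_power: "theta_phi (q ^ k) = J (2 * k) q ^ 5 / (J k q ^ 2 * J (4 * k) q ^ 2)"
  by (simp add: theta_phi_def J_power)

lemma theta_psi_power: "theta_psi (q ^ k) = J (2 * k) q ^ 2 / J k q"
  by (simp add: theta_psi_def J_power)

lemma theta_phi_minus:
  assumes "norm q < 1"
  shows "theta_phi (- q) = J 1 q ^ 2 / J 2 q"
  using assms unfolding theta_phi_def J_1_minus[OF assms]
  by (simp add: J_minus_even field_simps power_numeral_reduce)

lemma qtheta_eq_theta_phi: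
  assumes "norm q < 1" "q \<noteq> 0"
  shows "qtheta (- q) (q\<^sup>2) = theta_phi q / J 2 q"
proof -
  have "q\<^sup>2 / (- q) = - q"
    using assms by (simp add: power2_eq_square)
  then have "qtheta (- q) (q\<^sup>2) = (J 2 q ^ 2 / (J 1 q * J 4 q))\<^sup>2"
    by (simp add: qtheta_def qpoch_inf_minus_odd_J[OF assms(1)] power2_eq_square[of "_ / _"])
  then show ?thesis
    using assms by (simp add: theta_phi_def field_simps power_numeral_reduce)
qed

lemma qtheta_odd_J:
  assumes "norm q < 1" "q \<noteq> 0"
  shows "qtheta q (q\<^sup>2) = J 1 q ^ 2 / J 2 q ^ 2"
  using qtheta_eq_theta_phi[of "- q"] assms
  by (simp add: theta_phi_minus J_minus_even power2_eq_square)

lemma qtheta_eq_theta_psi: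
  assumes "norm q < 1" "q \<noteq> 0"
  shows "qtheta (- q) (q ^ 4) = theta_psi q / J 4 q"
proof -
  have q2: "norm (q\<^sup>2) < 1"
    using norm_power_less_1[OF assms(1)] by simp
  have "qtheta (- q) (q ^ 4) = qpoch_inf (- q) (q\<^sup>2)"
    using qpoch_inf_even_odd[OF q2, of "- q"] assms
    by (simp add: qtheta_def power_mult[symmetric] power_Suc[symmetric] eval_nat_numeral mult_ac)
  then show ?thesis
    by (simp add: qpoch_inf_minus_odd_J[OF assms(1)] theta_psi_def)
qed

lemma qtheta_minus_1:
  assumes "norm q < 1"
  shows "qtheta (- 1) q = 2 * theta_psi q / J 1 q"
  using qpoch_inf_rec[OF assms, of "-1"] qpoch_inf_minus_J[OF assms]
  by (simp add: qtheta_def theta_psi_def power2_eq_square)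

lemma qtheta_bisection:
  assumes q: "norm q < 1" "q \<noteq> 0" and "x \<noteq> 0"
  shows "J 1 q * qtheta x q = J 4 q * (qtheta (- q * x\<^sup>2) (q ^ 4) - x * qtheta (- (q ^ 3) * x\<^sup>2) (q ^ 4))"
proof -
  have q4: "norm (q ^ 4) < 1" "q ^ 4 \<noteq> 0"
    using norm_power_less_1[OF q(1)] q by auto
  define R where "R x = qtheta (- q * x\<^sup>2) (q ^ 4) - x * qtheta (- (q ^ 3) * x\<^sup>2) (q ^ 4)" for x
  have swap: "qtheta (- (q ^ 3)) (q ^ 4) = qtheta (- q) (q ^ 4)"
    using qtheta_reflect[OF q4(2), of "- q"] q by (simp add: eval_nat_numeral)
  have "R x * qtheta (-1) q = R (-1) * qtheta x q"
  proof (rule qtheta_unique[OF q])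
    show "R holomorphic_on - {0}"
      unfolding R_def using q q4 by (intro holomorphic_intros) auto
    show "R (q * x) = - R x / x" if "x \<noteq> 0" for x
    proof -
      have args: "- q * (q * x)\<^sup>2 = - (q ^ 3) * x\<^sup>2" "- (q ^ 3) * (q * x)\<^sup>2 = q ^ 4 * (- q * x\<^sup>2)"
        by (simp_all add: eval_nat_numeral)
      have "- q * x\<^sup>2 \<noteq> 0"
        using q that by simp
      then show ?thesis
        unfolding R_def args qtheta_shift[OF q4 \<open>- q * x\<^sup>2 \<noteq> 0\<close>]
        using q that by (simp add: field_simps power2_eq_square)
    qed
    show "R 1 = 0"
      by (simp add: R_def swap)
  qed fact
  moreover have "R (-1) = 2 * theta_psi q / J 4 q"
    by (simp add: R_def swap qtheta_eq_theta_psi[OF q])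
  ultimately have "theta_psi q * (J 4 q * R x) = theta_psi q * (J 1 q * qtheta x q)"
    using q by (simp add: qtheta_minus_1 field_simps)
  moreover have "theta_psi q \<noteq> 0"
    using q by (simp add: theta_psi_def)
  ultimately show ?thesis
    unfolding R_def by simp
qed

lemma theta_phi_bisection:
  assumes q: "norm q < 1" "q \<noteq> 0"
  shows "theta_phi q = theta_phi (q ^ 4) + 2 * q * theta_psi (q ^ 8)"
proof -
  have powers: "norm (q\<^sup>2) < 1" "norm (q ^ 4) < 1" "norm (q ^ 8) < 1" "q\<^sup>2 \<noteq> 0" "q ^ 4 \<noteq> 0" "q ^ 8 \<noteq> 0"
    using norm_power_less_1[OF q(1)] q by auto
  have args: "- (q\<^sup>2) * (- q)\<^sup>2 = - (q ^ 4)" "- ((q\<^sup>2) ^ 3) * (- q)\<^sup>2 = - (q ^ 8)" "(q\<^sup>2) ^ 4 = q ^ 8"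
    by (simp_all add: power_add[symmetric] power_mult[symmetric])
  have "qtheta (- (q ^ 4)) (q ^ 8) = theta_phi (q ^ 4) / J 8 q"
    using qtheta_eq_theta_phi[OF powers(2,5)] by (simp add: J_power power_mult[symmetric])
  moreover have "qtheta (- (q ^ 8)) (q ^ 8) = 2 * theta_psi (q ^ 8) / J 8 q"
    using qtheta_minus_1[OF powers(3)] qtheta_reflect[OF powers(6), of "-1"] by (simp add: J_power)
  ultimately have "J 2 q * qtheta (- q) (q\<^sup>2) = theta_phi (q ^ 4) + 2 * q * theta_psi (q ^ 8)"
    using qtheta_bisection[OF powers(1,4), of "- q"] q
    unfolding args J_power by (simp add: distrib_left)
  then show ?thesis
    using q by (simp add: qtheta_eq_theta_phi[OF q])
qed

lemma theta_phi_mult_minus: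
  assumes "norm q < 1"
  shows "theta_phi q * theta_phi (- q) = theta_phi (- (q\<^sup>2)) ^ 2"
proof -
  have "norm (q\<^sup>2) < 1"
    using norm_power_less_1[OF assms] by simp
  then show ?thesis
    unfolding theta_phi_minus[OF assms] theta_phi_minus[OF \<open>norm (q\<^sup>2) < 1\<close>]
    using assms by (simp add: J_power theta_phi_def) (simp add: field_simps power_numeral_reduce)
qed

lemma theta_phi_square:
  assumes q: "norm q < 1" "q \<noteq> 0"
  shows "theta_phi q ^ 2 = theta_phi (q\<^sup>2) ^ 2 + 4 * q * theta_psi (q ^ 4) ^ 2"
proof -
  define p where "p = csqrt (- q)"
  have p: "p\<^sup>2 = - q" "norm p < 1" "p \<noteq> 0"
    using q by (auto simp: p_def)
  have powers: "p ^ 4 = q\<^sup>2" "p ^ 8 = q ^ 4"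
    using power_mult[of p 2 2] power_mult[of p 2 4] by (simp_all add: p)
  have "theta_phi q ^ 2 = theta_phi p * theta_phi (- p)"
    unfolding theta_phi_mult_minus[OF p(2)] p(1) by simp
  also have "\<dots> = (theta_phi (q\<^sup>2) + 2 * p * theta_psi (q ^ 4)) * (theta_phi (q\<^sup>2) - 2 * p * theta_psi (q ^ 4))"
    using theta_phi_bisection[OF p(2,3)] theta_phi_bisection[of "- p"] p by (simp add: powers)
  also have "\<dots> = theta_phi (q\<^sup>2) ^ 2 - 4 * p\<^sup>2 * theta_psi (q ^ 4) ^ 2"
    by (simp add: power2_eq_square algebra_simps)
  finally show ?thesis
    unfolding p(1) by simp
qed

section \<open>Dissections of g\<close>

lemma gnum_dissection:
  assumes q: "norm q < 1" "q \<noteq> 0" and "x \<noteq> 0"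
  defines "a \<equiv> \<lambda>x. qtheta (- q * x\<^sup>2) (q ^ 4)" and "b \<equiv> \<lambda>x. qtheta (- q / x\<^sup>2) (q ^ 4)"
    and "A \<equiv> \<lambda>x. gnum (- q * x\<^sup>2) (q ^ 4)" and "B \<equiv> \<lambda>x. gnum (- q / x\<^sup>2) (q ^ 4)"
  shows "x * (a x * b x) * gnum x q + qtheta x q * (a x * b x - q / x\<^sup>2 * a x * B x + q * x * b x * A x)
    = J 2 q ^ 4 / (J 1 q * J 4 q ^ 2)"
proof -
  have q4: "norm (q ^ 4) < 1" "q ^ 4 \<noteq> 0"
    using norm_power_less_1[OF q(1)] q by auto
  define F where "F x = x * (a x * b x) * gnum x q +
    qtheta x q * (a x * b x - q / x\<^sup>2 * a x * B x + q * x * b x * A x)" for x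
  have periodic: "F (q * x) = F x" if "x \<noteq> 0" for x
  proof -
    have args: "- q * (q * x)\<^sup>2 = q ^ 4 / (- q / x\<^sup>2)" "- q / (q * x)\<^sup>2 = q ^ 4 / (q ^ 4 * (- q * x\<^sup>2))"
      using q that by (simp_all add: field_simps power_numeral_reduce)
    have nonzero: "- q * x\<^sup>2 \<noteq> 0"
      using q that by simp
    have shifts: "a (q * x) = b x" "A (q * x) = B x" "b (q * x) = a x / (q * x\<^sup>2)"
      "B (q * x) = (q * x\<^sup>2)\<^sup>2 * A x + (1 - q * x\<^sup>2) * a x"
      unfolding a_def b_def A_def B_def args qtheta_reflect[OF q4(2)] gnum_reflect[OF q4(2)]
        qtheta_shift[OF q4 nonzero] gnum_shift[OF q4 nonzero]
      by simp_all
    show ?thesis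
      unfolding F_def shifts gnum_shift[OF q that] qtheta_shift[OF q that]
      using q that by (simp add: field_simps) algebra
  qed
  have "F holomorphic_on - {0}"
    unfolding F_def a_def b_def A_def B_def using q q4 by (intro holomorphic_intros) auto
  from q_periodic_constant[OF q this periodic \<open>x \<noteq> 0\<close>] have "F x = F 1" .
  also have "F 1 = J 2 q ^ 4 / (J 1 q * J 4 q ^ 2)"
    using q by (simp add: F_def a_def b_def qtheta_1 qtheta_eq_theta_psi gnum_1)
      (simp add: theta_psi_def J_def field_simps power_numeral_reduce)
  finally show ?thesis
    unfolding F_def .
qed

lemma g_dissection:
  assumes q: "norm q < 1" "q \<noteq> 0" and "x \<noteq> 0"
    and nonzero: "qtheta x q \<noteq> 0" "qtheta (- q * x\<^sup>2) (q ^ 4) \<noteq> 0" "qtheta (- q / x\<^sup>2) (q ^ 4) \<noteq> 0"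
  shows "g x q = - 1 / x + q / x ^ 3 * g (- q / x\<^sup>2) (q ^ 4) - q * g (- q * x\<^sup>2) (q ^ 4) +
    J 2 q ^ 4 / (J 1 q * J 4 q ^ 2) / (x * qtheta x q * qtheta (- q * x\<^sup>2) (q ^ 4) * qtheta (- q / x\<^sup>2) (q ^ 4))"
proof -
  have q4: "norm (q ^ 4) < 1"
    using norm_power_less_1[OF q(1)] by simp
  have args: "- q * x\<^sup>2 \<noteq> 0" "- q / x\<^sup>2 \<noteq> 0"
    using assms by auto
  show ?thesis
    unfolding g_eq_gnum[OF q(1) \<open>x \<noteq> 0\<close> nonzero(1)] g_eq_gnum[OF q4 args(1) nonzero(2)]
      g_eq_gnum[OF q4 args(2) nonzero(3)]
    unfolding gnum_dissection[OF q \<open>x \<noteq> 0\<close>, symmetric] using assms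
    by (simp add: field_simps power_numeral_reduce)
qed

lemma gnum_even_part:
  assumes q: "norm q < 1" "q \<noteq> 0" and "x \<noteq> 0"
  shows "qtheta (- q * x\<^sup>2) (q ^ 4) * (qtheta (- x) q * gnum x q + qtheta x q * gnum (- x) q)
    + 2 * q * qtheta x q * qtheta (- x) q * gnum (- q * x\<^sup>2) (q ^ 4) = 2 * J 2 q ^ 4 / (J 1 q ^ 2 * J 4 q)"
proof -
  have q2: "norm (q\<^sup>2) < 1" "q\<^sup>2 \<noteq> 0" and q4: "norm (q ^ 4) < 1" "q ^ 4 \<noteq> 0"
    using norm_power_less_1[OF q(1)] q by auto
  define F where "F x = qtheta (- q * x\<^sup>2) (q ^ 4) * (qtheta (- x) q * gnum x q + qtheta x q * gnum (- x) q)
    + 2 * q * qtheta x q * qtheta (- x) q * gnum (- q * x\<^sup>2) (q ^ 4)" for x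
  have periodic: "F (q\<^sup>2 * x) = F x" if "x \<noteq> 0" for x
  proof -
    have args: "- q * (q * (q * x))\<^sup>2 = q ^ 4 * (- q * x\<^sup>2)" "- (q * (q * x)) = q * (q * - x)" "q\<^sup>2 * x = q * (q * x)"
      by (simp_all add: eval_nat_numeral)
    have nonzero: "- q * x\<^sup>2 \<noteq> 0" "q * x \<noteq> 0" "- x \<noteq> 0" "q * - x \<noteq> 0"
      using q that by simp_all
    show ?thesis
      unfolding args(3) F_def args(1,2) qtheta_shift[OF q4 nonzero(1)] gnum_shift[OF q4 nonzero(1)]
        qtheta_shift[OF q nonzero(2)] qtheta_shift[OF q nonzero(4)]
        gnum_shift[OF q nonzero(2)] gnum_shift[OF q nonzero(4)]
        qtheta_shift[OF q that] qtheta_shift[OF q nonzero(3)] gnum_shift[OF q that] gnum_shift[OF q nonzero(3)]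
      using q that by (simp add: field_simps) algebra
  qed
  have "F holomorphic_on - {0}"
    unfolding F_def using q q4 by (intro holomorphic_intros) auto
  from q_periodic_constant[OF q2 this periodic \<open>x \<noteq> 0\<close>] have "F x = F 1" .
  also have "F 1 = 2 * J 2 q ^ 4 / (J 1 q ^ 2 * J 4 q)"
    using q by (simp add: F_def qtheta_1 qtheta_eq_theta_psi qtheta_minus_1 gnum_1)
      (simp add: theta_psi_def J_def field_simps power_numeral_reduce)
  finally show ?thesis
    unfolding F_def .
qed

lemma g_even_part:
  assumes q: "norm q < 1" "q \<noteq> 0" and "x \<noteq> 0"
    and nonzero: "qtheta (x\<^sup>2) (q\<^sup>2) \<noteq> 0" "qtheta (- q * x\<^sup>2) (q ^ 4) \<noteq> 0"
  shows "g x q + g (- x) q = 2 * J 2 q ^ 4 / (J 1 q ^ 2 * J 4 q) / (qtheta (x\<^sup>2) (q\<^sup>2) * qtheta (- q * x\<^sup>2) (q ^ 4))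
    - 2 * q * g (- q * x\<^sup>2) (q ^ 4)"
proof -
  have q4: "norm (q ^ 4) < 1"
    using norm_power_less_1[OF q(1)] by simp
  have factors: "qtheta x q \<noteq> 0" "qtheta (- x) q \<noteq> 0"
    using nonzero(1) unfolding qtheta_mult_minus[OF q(1), symmetric] by auto
  have args: "- q * x\<^sup>2 \<noteq> 0" "- x \<noteq> 0"
    using assms by auto
  show ?thesis
    unfolding g_eq_gnum[OF q(1) \<open>x \<noteq> 0\<close> factors(1)] g_eq_gnum[OF q(1) args(2) factors(2)]
      g_eq_gnum[OF q4 args(1) nonzero(2)] qtheta_mult_minus[OF q(1), symmetric]
    unfolding gnum_even_part[OF q \<open>x \<noteq> 0\<close>, symmetric] using factors nonzero(2)
    by (simp add: field_simps)
qed

text \<open>The odd and even parts of the third-order mock theta function \<open>\<omega>(q) = g(q; q\<^sup>2)\<close> are \<open>omega_odd (q\<^sup>2) / q\<close> and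
  \<open>omega_even (q\<^sup>2)\<close>.\<close>

definition omega_odd :: "complex \<Rightarrow> complex" where
  "omega_odd q = - 1 + g (- 1) (q ^ 4) + 1 / 2 * (J 2 q ^ 6 * J 4 q / (J 1 q ^ 4 * J 8 q ^ 2))"

definition omega_even :: "complex \<Rightarrow> complex" where
  "omega_even q = - (q * g (- (q ^ 2)) (q ^ 4)) + J 2 q ^ 8 * J 8 q ^ 2 / (J 1 q ^ 4 * J 4 q ^ 5)"

lemma omega_bisection:
  assumes q: "norm q < 1" "q \<noteq> 0"
  shows "g q (q\<^sup>2) = omega_odd (q\<^sup>2) / q + omega_even (q\<^sup>2)"
proof -
  have powers: "norm (q\<^sup>2) < 1" "norm (q ^ 4) < 1" "norm (q ^ 8) < 1" "q\<^sup>2 \<noteq> 0" "q ^ 4 \<noteq> 0"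
    using norm_power_less_1[OF q(1)] q by auto
  have args: "- (q\<^sup>2) * q\<^sup>2 = - (q ^ 4)" "- (q\<^sup>2) / q\<^sup>2 = - 1" "(q\<^sup>2) ^ 4 = q ^ 8" "(q\<^sup>2)\<^sup>2 = q ^ 4"
    using q by (auto simp: power_numeral_reduce)
  have thetas: "qtheta q (q\<^sup>2) = J 1 q ^ 2 / J 2 q ^ 2" "qtheta (- (q ^ 4)) (q ^ 8) = theta_phi (q ^ 4) / J 8 q"
    "qtheta (- 1) (q ^ 8) = 2 * theta_psi (q ^ 8) / J 8 q"
    using qtheta_odd_J[OF q] qtheta_eq_theta_phi[OF powers(2,5)] qtheta_minus_1[OF powers(3)]
    by (simp_all add: J_power flip: power_mult)
  have nonzero: "qtheta q (q\<^sup>2) \<noteq> 0" "qtheta (- (q ^ 4)) (q ^ 8) \<noteq> 0" "qtheta (- 1) (q ^ 8) \<noteq> 0"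
    unfolding thetas theta_phi_power theta_psi_power using q by simp_all
  have "g q (q\<^sup>2) = - 1 / q + q\<^sup>2 / q ^ 3 * g (- 1) (q ^ 8) - q\<^sup>2 * g (- (q ^ 4)) (q ^ 8) +
      J 4 q ^ 4 / (J 2 q * J 8 q ^ 2) /
        (q * qtheta q (q\<^sup>2) * qtheta (- (q ^ 4)) (q ^ 8) * qtheta (- 1) (q ^ 8))"
    using g_dissection[OF powers(1,4) q(2)] nonzero unfolding args J_power by simp
  also have "J 4 q ^ 4 / (J 2 q * J 8 q ^ 2) /
        (q * qtheta q (q\<^sup>2) * qtheta (- (q ^ 4)) (q ^ 8) * qtheta (- 1) (q ^ 8)) =
      J 4 q ^ 8 / (2 * q * J 2 q ^ 4 * J 8 q ^ 4) * theta_phi q"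
    unfolding thetas theta_phi_power theta_psi_power unfolding theta_phi_def
    using q by (simp add: field_simps power_numeral_reduce)
  also have "\<dots> = 1 / 2 * (J 4 q ^ 6 * J 8 q / (J 2 q ^ 4 * J 16 q ^ 2)) / q
      + J 4 q ^ 8 * J 16 q ^ 2 / (J 2 q ^ 4 * J 8 q ^ 5)"
    unfolding theta_phi_bisection[OF q] theta_phi_power theta_psi_power
    using q by (simp add: distrib_left add_divide_distrib power_numeral_reduce mult_ac)
  finally show ?thesis
    unfolding omega_odd_def omega_even_def J_power args using q
    by (simp add: add_divide_distrib diff_divide_distrib power_numeral_reduce)
qed

lemma omega_minus_bisection:
  assumes q: "norm q < 1" "q \<noteq> 0"
  shows "g (- q) (q\<^sup>2) = - omega_odd (q\<^sup>2) / q + omega_even (q\<^sup>2)"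
  using omega_bisection[of "- q"] q by simp

text \<open>The value \<open>g(\<i>q; q\<^sup>2)\<close> is \<open>\<nu>(q\<^sup>2)\<close> for the third-order mock theta function \<open>\<nu>\<close>.\<close>

lemma g_imaginary:
  assumes q: "norm q < 1" "q \<noteq> 0"
  shows "g (\<i> * q) (q\<^sup>2) = J 8 q ^ 3 / J 4 q ^ 2 - q\<^sup>2 * g (q ^ 4) (q ^ 8)"
    and "g (- \<i> * q) (q\<^sup>2) = g (\<i> * q) (q\<^sup>2)"
proof -
  have powers: "norm (q\<^sup>2) < 1" "norm (q ^ 4) < 1" "q\<^sup>2 \<noteq> 0" "q ^ 4 \<noteq> 0"
    using norm_power_less_1[OF q(1)] q by auto
  have args: "(\<i> * q)\<^sup>2 = - (q\<^sup>2)" "(q\<^sup>2)\<^sup>2 = q ^ 4" "- (q\<^sup>2) * - (q\<^sup>2) = q ^ 4" "(q\<^sup>2) ^ 4 = q ^ 8"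
    by (simp_all add: power_mult_distrib flip: power_mult power_add)
  have thetas: "qtheta (- (q\<^sup>2)) (q ^ 4) = theta_phi (q\<^sup>2) / J 4 q" "qtheta (q ^ 4) (q ^ 8) = J 4 q ^ 2 / J 8 q ^ 2"
    using qtheta_eq_theta_phi[OF powers(1,3)] qtheta_odd_J[OF powers(2,4)]
    by (simp_all add: J_power flip: power_mult)
  have nonzero: "qtheta (- (q\<^sup>2)) (q ^ 4) \<noteq> 0" "qtheta (q ^ 4) (q ^ 8) \<noteq> 0"
    unfolding thetas theta_phi_power using q by simp_all
  have "qtheta (\<i> * q) (q\<^sup>2) \<noteq> 0"
    using nonzero(1) qtheta_mult_minus[OF powers(1), of "\<i> * q"] unfolding args by auto
  moreover have "q\<^sup>2 / (\<i> * q) = - \<i> * q"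
    using q by (simp add: power2_eq_square)
  ultimately show reflect: "g (- \<i> * q) (q\<^sup>2) = g (\<i> * q) (q\<^sup>2)"
    using g_reflect[OF powers(1,3), of "\<i> * q"] q by simp
  have "2 * g (\<i> * q) (q\<^sup>2) = 2 * J 4 q ^ 4 / (J 2 q ^ 2 * J 8 q) /
      (qtheta (- (q\<^sup>2)) (q ^ 4) * qtheta (q ^ 4) (q ^ 8)) - 2 * q\<^sup>2 * g (q ^ 4) (q ^ 8)"
    using g_even_part[OF powers(1,3), of "\<i> * q"] nonzero q reflect unfolding args J_power by simp
  also have "2 * J 4 q ^ 4 / (J 2 q ^ 2 * J 8 q) / (qtheta (- (q\<^sup>2)) (q ^ 4) * qtheta (q ^ 4) (q ^ 8)) =
      2 * (J 8 q ^ 3 / J 4 q ^ 2)"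
    unfolding thetas theta_phi_power using q by (simp add: field_simps power_numeral_reduce)
  finally have "2 * g (\<i> * q) (q\<^sup>2) = 2 * (J 8 q ^ 3 / J 4 q ^ 2 - q\<^sup>2 * g (q ^ 4) (q ^ 8))"
    by (simp add: right_diff_distrib)
  then show "g (\<i> * q) (q\<^sup>2) = J 8 q ^ 3 / J 4 q ^ 2 - q\<^sup>2 * g (q ^ 4) (q ^ 8)"
    by (simp only: mult_cancel_left) simp
qed

section \<open>Generating functions of odd Durfee symbols\<close>

lemma has_sum_Times_complex:
  fixes a b :: complex
  assumes "(f has_sum a) A" "(h has_sum b) B"
  shows "((\<lambda>(x, y). f x * h y) has_sum (a * b)) (A \<times> B)"
proof (rule has_sum_SigmaI)
  show "((\<lambda>y. case (x, y) of (x, y) \<Rightarrow> f x * h y) has_sum (f x * b)) B" for x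
    using has_sum_cmult_right[OF assms(2)] by simp
  show "((\<lambda>x. f x * b) has_sum (a * b)) A"
    using assms(1) by (rule has_sum_cmult_left)
  have norms: "(\<lambda>x. norm (f x)) summable_on A" "(\<lambda>y. norm (h y)) summable_on B"
    using assms by (auto simp: summable_on_iff_abs_summable_on_complex[symmetric] dest: has_sum_imp_summable)
  show "(\<lambda>(x, y). f x * h y) summable_on (A \<times> B)"
  proof (rule abs_summable_summable, subst Infinite_Sum.abs_summable_on_Sigma_iff, intro conjI ballI)
    show "(\<lambda>y. norm (case (x, y) of (x, y) \<Rightarrow> f x * h y)) summable_on B" for x
      using summable_on_cmult_right[OF norms(2)] by (simp add: norm_mult)
    show "(\<lambda>x. norm (\<Sum>\<^sub>\<infinity>y\<in>B. norm (case (x, y) of (x, y) \<Rightarrow> f x * h y))) summable_on A"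
      using summable_on_cmult_left[OF norms(1)] by (simp add: norm_mult infsum_cmult_right' abs_mult)
  qed
qed

lemma has_sum_fibres:
  fixes f :: "'a \<Rightarrow> 'b :: {topological_comm_monoid_add, t3_space}"
  assumes "(f has_sum S) A" "\<And>n. finite {x \<in> A. h x = n}"
  shows "((\<lambda>n. \<Sum>x | x \<in> A \<and> h x = n. f x) has_sum S) UNIV"
proof (rule has_sum_SigmaD)
  have "((\<lambda>(n, x). f x) has_sum S) (SIGMA n:UNIV. {x \<in> A. h x = n}) \<longleftrightarrow> (f has_sum S) A"
    by (rule has_sum_reindex_bij_witness[where j = snd and i = "\<lambda>x. (h x, x)"]) auto
  then show "((\<lambda>(n, x). f x) has_sum S) (SIGMA n:UNIV. {x \<in> A. h x = n})"
    using assms(1) by simp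
  show "((\<lambda>x. case (n, x) of (n, x) \<Rightarrow> f x) has_sum (\<Sum>x | x \<in> A \<and> h x = n. f x)) {x \<in> A. h x = n}" for n
    using has_sum_finite[OF assms(2)] by simp
qed

definition odd_rows :: "nat \<Rightarrow> nat list set" where
  "odd_rows k = {as. sorted_wrt (\<ge>) as \<and> (\<forall>x\<in>set as. odd x \<and> x < 2 * k)}"

lemma odd_rows_0: "odd_rows 0 = {[]}"
  by (auto simp: odd_rows_def)

lemma odd_rows_Suc_cases:
  assumes "as \<in> odd_rows (Suc k)"
  obtains m bs where "as = replicate m (2 * k + 1) @ bs" "bs \<in> odd_rows k"
  using assms
proof (induction as arbitrary: thesis)
  case Nil
  then show ?case
    using Nil(1)[of 0 "[]"] by (simp add: odd_rows_def)
next
  case (Cons a as)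
  then have "as \<in> odd_rows (Suc k)" and a: "a = 2 * k + 1 \<or> a < 2 * k"
    by (auto simp: odd_rows_def less_Suc_eq)
  with Cons.IH obtain m bs where as: "as = replicate m (2 * k + 1) @ bs" "bs \<in> odd_rows k"
    by blast
  from a show ?case
  proof
    assume "a = 2 * k + 1"
    then show ?case
      using as by (intro Cons.prems(1)[of "Suc m" bs]) auto
  next
    assume "a < 2 * k"
    then have "a # as \<in> odd_rows k"
      using Cons.prems(2) by (auto simp: odd_rows_def)
    then show ?case
      using Cons.prems(1)[of 0 "a # as"] by simp
  qed
qed

lemma Cons_in_odd_rows:
  assumes "as \<in> odd_rows (Suc k)"
  shows "(2 * k + 1) # as \<in> odd_rows (Suc k)"
  using assms by (auto simp: odd_rows_def less_Suc_eq_le)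

lemma replicate_append_in_odd_rows:
  assumes "as \<in> odd_rows k"
  shows "replicate m (2 * k + 1) @ as \<in> odd_rows (Suc k)"
proof (induction m)
  case 0
  then show ?case
    using assms unfolding odd_rows_def by force
next
  case (Suc m)
  then show ?case
    using Cons_in_odd_rows by simp
qed

lemma takeWhile_replicate_append_odd_rows:
  assumes "as \<in> odd_rows k"
  shows "takeWhile ((=) (2 * k + 1)) (replicate m (2 * k + 1) @ as) = replicate m (2 * k + 1)"
proof -
  have "takeWhile ((=) (2 * k + 1)) as = []"
    using assms by (cases as) (auto simp: odd_rows_def)
  then show ?thesis
    by (induction m) auto
qed

lemma bij_betw_odd_rows_Suc:
  "bij_betw (\<lambda>(m, as). replicate m (2 * k + 1) @ as) (UNIV \<times> odd_rows k) (odd_rows (Suc k))"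
proof (rule bij_betw_imageI)
  show "inj_on (\<lambda>(m, as). replicate m (2 * k + 1) @ as) (UNIV \<times> odd_rows k)"
  proof (rule inj_onI, clarify)
    fix m as m' as'
    assume eq: "replicate m (2 * k + 1) @ as = replicate m' (2 * k + 1) @ as'" and "as \<in> odd_rows k" "as' \<in> odd_rows k"
    then have "replicate m (2 * k + 1) = replicate m' (2 * k + 1)"
      using takeWhile_replicate_append_odd_rows by metis
    with eq show "m = m' \<and> as = as'"
      by simp
  qed
  show "(\<lambda>(m, as). replicate m (2 * k + 1) @ as) ` (UNIV \<times> odd_rows k) = odd_rows (Suc k)"
  proof (intro equalityI subsetI)
    fix as assume "as \<in> odd_rows (Suc k)"
    then obtain m bs where "as = replicate m (2 * k + 1) @ bs" "bs \<in> odd_rows k"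
      by (rule odd_rows_Suc_cases)
    then show "as \<in> (\<lambda>(m, as). replicate m (2 * k + 1) @ as) ` (UNIV \<times> odd_rows k)"
      by (intro image_eqI[of _ _ "(m, bs)"]) auto
  next
    fix as assume "as \<in> (\<lambda>(m, as). replicate m (2 * k + 1) @ as) ` (UNIV \<times> odd_rows k)"
    then obtain m bs where "as = replicate m (2 * k + 1) @ bs" "bs \<in> odd_rows k"
      by auto
    then show "as \<in> odd_rows (Suc k)"
      by (simp only: replicate_append_in_odd_rows)
  qed
qed

lemma odd_rows_has_sum:
  fixes z q :: complex
  assumes "norm q < 1" "norm (z * q) < 1"
  shows "((\<lambda>as. z ^ length as * q ^ sum_list as) has_sum inverse (qpoch (z * q) (q\<^sup>2) k)) (odd_rows k)"
proof (induction k)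
  case 0
  show ?case
    unfolding odd_rows_0 by (rule has_sum_finiteI) (auto simp: qpoch_def)
next
  case (Suc k)
  define c where "c = z * q * (q\<^sup>2) ^ k"
  have "norm c < 1"
    using norm_mult_power_le[of "q\<^sup>2" "z * q" k] assms norm_power_less_1[OF assms(1), of 2] by (simp add: c_def)
  then have "((\<lambda>m. c ^ m) has_sum (1 / (1 - c))) UNIV"
    by (intro norm_summable_imp_has_sum geometric_sums) (auto simp: norm_power)
  from has_sum_Times_complex[OF this Suc]
  have "((\<lambda>(m, as). c ^ m * (z ^ length as * q ^ sum_list as)) has_sum
      (1 / (1 - c) * inverse (qpoch (z * q) (q\<^sup>2) k))) (UNIV \<times> odd_rows k)" .
  also have "1 / (1 - c) * inverse (qpoch (z * q) (q\<^sup>2) k) = inverse (qpoch (z * q) (q\<^sup>2) (Suc k))"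
    by (simp add: qpoch_def c_def divide_inverse)
  finally have "((\<lambda>(m, as). c ^ m * (z ^ length as * q ^ sum_list as)) has_sum
      inverse (qpoch (z * q) (q\<^sup>2) (Suc k))) (UNIV \<times> odd_rows k)" .
  moreover have "c ^ m * (z ^ length as * q ^ sum_list as) =
      z ^ length (replicate m (2 * k + 1) @ as) * q ^ sum_list (replicate m (2 * k + 1) @ as)" for m as
  proof -
    have "c ^ m = z ^ m * q ^ ((2 * k + 1) * m)"
      unfolding power_mult by (simp add: c_def power_mult_distrib power_mult)
    then show ?thesis
      by (simp add: sum_list_replicate power_add mult_ac)
  qed
  ultimately show ?case
    by (subst has_sum_reindex_bij_betw[OF bij_betw_odd_rows_Suc, symmetric]) (simp add: case_prod_unfold)
qed

definition odd_durfee_size :: "nat \<times> nat list \<times> nat list \<Rightarrow> nat" where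
  "odd_durfee_size = (\<lambda>(D, as, bs). sum_list as + sum_list bs + 2 * D\<^sup>2 + 2 * D + 1)"

definition all_odd_durfee_symbols :: "(nat \<times> nat list \<times> nat list) set" where
  "all_odd_durfee_symbols = (SIGMA D:UNIV. odd_rows (Suc D) \<times> odd_rows (Suc D))"

lemma odd_durfee_symbols_eq_fibre:
  "odd_durfee_symbols n = {S \<in> all_odd_durfee_symbols. odd_durfee_size S = n}"
proof (rule set_eqI)
  fix S :: "nat \<times> nat list \<times> nat list"
  obtain D as bs where "S = (D, as, bs)"
    by (rule prod_cases3)
  moreover have "x \<le> 2 * D + 1 \<longleftrightarrow> x < 2 * Suc D" for x
    by auto
  ultimately show "S \<in> odd_durfee_symbols n \<longleftrightarrow> S \<in> {S \<in> all_odd_durfee_symbols. odd_durfee_size S = n}"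
    unfolding odd_durfee_symbols_def all_odd_durfee_symbols_def odd_durfee_size_def odd_rows_def by auto
qed

definition odd_durfee_weight :: "complex \<Rightarrow> complex \<Rightarrow> nat \<times> nat list \<times> nat list \<Rightarrow> complex" where
  "odd_durfee_weight z q S = z powi odd_rank S * q ^ odd_durfee_size S"

lemma norm_odd_durfee_weight:
  "of_real (norm (odd_durfee_weight z q S)) = odd_durfee_weight (of_real (norm z)) (of_real (norm q)) S"
  by (simp only: odd_durfee_weight_def norm_mult norm_power norm_power_int of_real_mult of_real_power of_real_power_int)

definition odd_durfee_term :: "complex \<Rightarrow> complex \<Rightarrow> nat \<Rightarrow> complex" where
  "odd_durfee_term z q D =
     q * ((q\<^sup>2) ^ (D * (D + 1)) / (qpoch (z * q) (q\<^sup>2) (Suc D) * qpoch (q / z) (q\<^sup>2) (Suc D)))"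

lemma odd_durfee_weight_has_sum_fixed_D:
  assumes "norm q < 1" "z \<noteq> 0" "norm (z * q) < 1" "norm (q / z) < 1"
  shows "((\<lambda>rows. odd_durfee_weight z q (D, rows)) has_sum odd_durfee_term z q D) (odd_rows (Suc D) \<times> odd_rows (Suc D))"
proof -
  define w where "w z as = z ^ length as * q ^ sum_list as" for z :: complex and as
  have "((\<lambda>(as, bs). w z as * w (inverse z) bs) has_sum
      inverse (qpoch (z * q) (q\<^sup>2) (Suc D)) * inverse (qpoch (inverse z * q) (q\<^sup>2) (Suc D)))
      (odd_rows (Suc D) \<times> odd_rows (Suc D))"
    unfolding w_def using assms by (intro has_sum_Times_complex odd_rows_has_sum) (simp_all add: field_simps)
  from has_sum_cmult_right[OF this, of "q * (q\<^sup>2) ^ (D * (D + 1))"]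
  have "((\<lambda>p. q * (q\<^sup>2) ^ (D * (D + 1)) * (case p of (as, bs) \<Rightarrow> w z as * w (inverse z) bs)) has_sum
      odd_durfee_term z q D)
      (odd_rows (Suc D) \<times> odd_rows (Suc D))"
    by (simp add: odd_durfee_term_def divide_inverse mult_ac)
  moreover have "odd_durfee_weight z q (D, as, bs) = q * (q\<^sup>2) ^ (D * (D + 1)) * (w z as * w (inverse z) bs)" for as bs
  proof -
    have "z powi (int (length as) - int (length bs)) = z ^ length as * inverse z ^ length bs"
      using assms(2) by (simp add: power_int_diff divide_inverse power_inverse)
    moreover have "odd_durfee_size (D, as, bs) = Suc (2 * (D * (D + 1)) + (sum_list as + sum_list bs))"
      by (simp add: odd_durfee_size_def power2_eq_square)
    then have "q ^ odd_durfee_size (D, as, bs) = q * ((q\<^sup>2) ^ (D * (D + 1)) * (q ^ sum_list as * q ^ sum_list bs))"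
      by (simp only: power_Suc power_add power_mult)
    ultimately show ?thesis
      by (simp add: odd_durfee_weight_def w_def mult_ac)
  qed
  ultimately show ?thesis
    by (subst has_sum_cong) auto
qed

lemma Bseq_inverse_qpoch:
  assumes "norm q < 1" "norm a < 1"
  shows "Bseq (\<lambda>n. inverse (qpoch a q n))"
  using tendsto_inverse[OF qpoch_LIMSEQ[OF assms(1)] qpoch_inf_nonzero[OF assms]]
  by (rule convergent_imp_Bseq[OF convergentI])

lemma summable_norm_odd_durfee_term:
  assumes "norm q < 1" "norm (z * q) < 1" "norm (q / z) < 1"
  shows "summable (\<lambda>D. norm (odd_durfee_term z q D))"
proof -
  have q2: "norm (q\<^sup>2) < 1"
    using norm_power_less_1[OF assms(1)] by simp
  have "Bseq (\<lambda>D. inverse (qpoch (z * q) (q\<^sup>2) (Suc D)) * inverse (qpoch (q / z) (q\<^sup>2) (Suc D)))"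
    using Bseq_inverse_qpoch[OF q2] assms by (intro Bseq_mult Bseq_ignore_initial_segment[where k = 1, simplified])
  then obtain B where "norm (inverse (qpoch (z * q) (q\<^sup>2) (Suc D)) * inverse (qpoch (q / z) (q\<^sup>2) (Suc D))) \<le> B" for D
    unfolding Bseq_def by blast
  then have "summable (\<lambda>D. norm q * norm ((q\<^sup>2) ^ (D * (D + 1)) *
      (inverse (qpoch (z * q) (q\<^sup>2) (Suc D)) * inverse (qpoch (q / z) (q\<^sup>2) (Suc D)))))"
    by (intro summable_mult summable_norm_power_mult_bounded q2) auto
  then show ?thesis
    by (simp add: odd_durfee_term_def divide_inverse norm_mult)
qed

lemma odd_durfee_weight_has_sum:
  assumes "norm q < 1" "q \<noteq> 0" "z \<noteq> 0" "norm (z * q) < 1" "norm (q / z) < 1"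
  shows "(odd_durfee_weight z q has_sum (q * g (z * q) (q\<^sup>2))) all_odd_durfee_symbols"
  unfolding all_odd_durfee_symbols_def
proof (rule has_sum_SigmaI)
  note fixed_D = odd_durfee_weight_has_sum_fixed_D[OF assms(1,3,4,5)]
  show "((\<lambda>rows. odd_durfee_weight z q (D, rows)) has_sum odd_durfee_term z q D)
      (odd_rows (Suc D) \<times> odd_rows (Suc D))" for D
    by (rule fixed_D)
  have q2: "norm (q\<^sup>2) < 1"
    using norm_power_less_1[OF assms(1)] by simp
  have "q\<^sup>2 / (z * q) = q / z"
    using assms by (simp add: power2_eq_square)
  moreover from this have "qtheta (z * q) (q\<^sup>2) \<noteq> 0"
    using assms qpoch_inf_nonzero[OF q2] by (simp add: qtheta_def)
  ultimately have "odd_durfee_term z q sums (q * g (z * q) (q\<^sup>2))"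
    unfolding odd_durfee_term_def using sums_mult[OF g_sums[OF q2, of "z * q"], of q] assms by simp
  then show "(odd_durfee_term z q has_sum (q * g (z * q) (q\<^sup>2))) UNIV"
    using summable_norm_odd_durfee_term assms by (intro norm_summable_imp_has_sum)
  have summable: "(\<lambda>rows. norm (odd_durfee_weight z q (D, rows))) summable_on odd_rows (Suc D) \<times> odd_rows (Suc D)" for D
    using has_sum_imp_summable[OF fixed_D] by (simp add: summable_on_iff_abs_summable_on_complex)
  have norm_sum: "of_real (\<Sum>\<^sub>\<infinity>rows\<in>odd_rows (Suc D) \<times> odd_rows (Suc D). norm (odd_durfee_weight z q (D, rows))) =
      odd_durfee_term (of_real (norm z)) (of_real (norm q)) D" for D
  proof (rule has_sum_unique)
    show "((\<lambda>rows. of_real (norm (odd_durfee_weight z q (D, rows)))) has_sum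
        odd_durfee_term (of_real (norm z)) (of_real (norm q)) D) (odd_rows (Suc D) \<times> odd_rows (Suc D))"
      unfolding norm_odd_durfee_weight
      using assms by (intro odd_durfee_weight_has_sum_fixed_D) (simp_all add: norm_mult norm_divide)
  qed (intro has_sum_of_real has_sum_infsum summable)
  have "summable (\<lambda>D. norm (odd_durfee_term (of_real (norm z)) (of_real (norm q)) D))"
    using assms by (intro summable_norm_odd_durfee_term) (simp_all add: norm_mult norm_divide)
  then have "(\<lambda>S. norm (odd_durfee_weight z q S)) summable_on (SIGMA D:UNIV. odd_rows (Suc D) \<times> odd_rows (Suc D))"
    unfolding norm_sum[symmetric]
    by (subst Infinite_Sum.abs_summable_on_Sigma_iff) (intro conjI ballI summable norm_summable_imp_summable_on, simp)
  then show "odd_durfee_weight z q summable_on (SIGMA D:UNIV. odd_rows (Suc D) \<times> odd_rows (Suc D))"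
    by (rule abs_summable_summable)
qed

lemma odd_rank_gen_fun:
  assumes "norm q < 1" "q \<noteq> 0" "z \<noteq> 0" "norm (z * q) < 1" "norm (q / z) < 1"
  shows "(\<lambda>n. (\<Sum>S\<in>odd_durfee_symbols n. z powi odd_rank S) * q ^ n) sums (q * g (z * q) (q\<^sup>2))"
proof -
  have "((\<lambda>n. \<Sum>S\<in>odd_durfee_symbols n. odd_durfee_weight z q S) has_sum (q * g (z * q) (q\<^sup>2))) UNIV"
    using has_sum_fibres[OF odd_durfee_weight_has_sum[OF assms], of odd_durfee_size] finite_odd_durfee_symbols
    unfolding odd_durfee_symbols_eq_fibre by blast
  moreover have "(\<Sum>S\<in>odd_durfee_symbols n. odd_durfee_weight z q S) =
      (\<Sum>S\<in>odd_durfee_symbols n. z powi odd_rank S) * q ^ n" for n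
    unfolding sum_distrib_right by (rule sum.cong) (auto simp: odd_durfee_weight_def odd_durfee_symbols_eq_fibre)
  ultimately show ?thesis
    by (simp add: has_sum_imp_sums)
qed

lemma sum_roots_unity_powi:
  assumes "M > 0"
  shows "(\<Sum>z | z ^ M = 1. z powi k) = (if int M dvd k then of_nat M else (0 :: complex))"
proof (cases "int M dvd k")
  case True
  then obtain j where "k = int M * j" ..
  then have "z powi k = 1" if "z ^ M = 1" for z :: complex
    using that by (simp add: power_int_mult)
  then have "(\<Sum>z :: complex | z ^ M = 1. z powi k) = (\<Sum>z :: complex | z ^ M = 1. 1)"
    by (intro sum.cong) auto
  then show ?thesis
    using True card_roots_unity_eq[OF assms] by simp
next
  case False
  define \<zeta> where "\<zeta> = cis (2 * pi / real M)"
  have \<zeta>: "\<zeta> ^ M = 1" "\<zeta> \<noteq> 0"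
    using assms by (simp_all add: \<zeta>_def Complex.DeMoivre)
  have "\<zeta> powi k \<noteq> 1"
  proof
    assume "\<zeta> powi k = 1"
    then have "Re (cis (of_int k * (2 * pi / real M))) = 1"
      unfolding \<zeta>_def cis_power_int by simp
    then obtain j :: int where "of_int k * (2 * pi / real M) = of_int j * 2 * pi"
      by (auto simp: cos_one_2pi_int)
    then have "of_int k = (of_int (int M * j) :: real)"
      using assms by (simp add: field_simps)
    then show False
      using False by (simp only: of_int_eq_iff) simp
  qed
  moreover have "bij_betw ((*) \<zeta>) {z. z ^ M = 1} {z. z ^ M = 1}"
    using \<zeta> by (intro bij_betw_byWitness[where f' = "\<lambda>z. z / \<zeta>"]) (auto simp: power_mult_distrib power_divide)
  from sum.reindex_bij_betw[OF this, of "\<lambda>z. z powi k"]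
  have "\<zeta> powi k * (\<Sum>z | z ^ M = 1. z powi k) = (\<Sum>z | z ^ M = 1. z powi k)"
    by (simp add: power_int_mult_distrib sum_distrib_left)
  ultimately show ?thesis
    using False by simp
qed

lemma N0_eq_sum_roots_unity:
  assumes "M > 0"
  shows "(of_nat (N0 a M n) :: complex) =
    (\<Sum>z | z ^ M = 1. z powi (- a) * (\<Sum>S\<in>odd_durfee_symbols n. z powi odd_rank S)) / of_nat M"
proof -
  have root_nonzero: "z \<noteq> 0" if "z ^ M = 1" for z :: complex
    using that assms by (auto simp: power_0_left)
  have "of_nat M * of_nat (N0 a M n) =
      (\<Sum>S\<in>odd_durfee_symbols n. if int M dvd odd_rank S - a then of_nat M else (0 :: complex))"
    by (simp add: N0_def cong_iff_dvd_diff finite_odd_durfee_symbols sum.If_cases Int_def)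
  also have "\<dots> = (\<Sum>S\<in>odd_durfee_symbols n. \<Sum>z | z ^ M = 1. z powi (odd_rank S - a))"
    by (simp only: sum_roots_unity_powi[OF assms])
  also have "\<dots> = (\<Sum>z | z ^ M = 1. \<Sum>S\<in>odd_durfee_symbols n. z powi (odd_rank S - a))"
    by (rule sum.swap)
  also have "\<dots> = (\<Sum>z | z ^ M = 1. z powi (- a) * (\<Sum>S\<in>odd_durfee_symbols n. z powi odd_rank S))"
    unfolding sum_distrib_left
    by (intro sum.cong refl) (auto simp: root_nonzero power_int_diff power_int_minus divide_inverse mult.commute)
  finally show ?thesis
    using assms by (simp add: field_simps)
qed

lemma N0_gen_fun:
  assumes "norm q < 1" "q \<noteq> 0" "M > 0"
  shows "(\<lambda>n. of_nat (N0 a M n) * q ^ n) sums ((\<Sum>z | z ^ M = 1. z powi (- a) * (q * g (z * q) (q\<^sup>2))) / of_nat M)"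
proof -
  have gen_fun: "(\<lambda>n. (\<Sum>S\<in>odd_durfee_symbols n. z powi odd_rank S) * q ^ n) sums (q * g (z * q) (q\<^sup>2))"
    if "z ^ M = 1" for z
  proof -
    have "norm z = 1"
      using power_eq_1_iff[OF that] assms(3) by simp
    then show ?thesis
      using assms by (intro odd_rank_gen_fun) (auto simp: norm_mult norm_divide)
  qed
  have "(\<lambda>n. (\<Sum>z | z ^ M = 1. z powi (- a) * ((\<Sum>S\<in>odd_durfee_symbols n. z powi odd_rank S) * q ^ n)) / of_nat M)
      sums ((\<Sum>z | z ^ M = 1. z powi (- a) * (q * g (z * q) (q\<^sup>2))) / of_nat M)"
    by (intro sums_divide sums_sum sums_mult gen_fun) simp
  then show ?thesis
    by (simp add: N0_eq_sum_roots_unity[OF assms(3)] sum_distrib_right mult.assoc)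
qed

lemma complex_fourth_roots_unity: "{z :: complex. z ^ 4 = 1} = {1, - 1, \<i>, - \<i>}"
proof -
  have "z ^ 4 - 1 = (z - 1) * (z + 1) * (z - \<i>) * (z + \<i>)" for z
    by (simp add: algebra_simps power_numeral_reduce)
  then have "z ^ 4 = 1 \<longleftrightarrow> z = 1 \<or> z = - 1 \<or> z = \<i> \<or> z = - \<i>" for z
    by (metis add_eq_0_iff2 eq_iff_diff_eq_0 mult_eq_0_iff)
  then show ?thesis
    by auto
qed

section \<open>Bisection of generating functions\<close>

text \<open>The origin is excluded since the generating functions below are written with negative powers of \<open>q\<close>.\<close>

definition has_gen_fun :: "(nat \<Rightarrow> complex) \<Rightarrow> (complex \<Rightarrow> complex) \<Rightarrow> bool" (infix "has'_gen'_fun" 46) where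
  "a has_gen_fun F \<longleftrightarrow> (\<forall>q. norm q < 1 \<longrightarrow> q \<noteq> 0 \<longrightarrow> (\<lambda>n. a n * q ^ n) sums F q)"

lemma has_gen_funI:
  assumes "\<And>q. norm q < 1 \<Longrightarrow> q \<noteq> 0 \<Longrightarrow> (\<lambda>n. a n * q ^ n) sums F q"
  shows "a has_gen_fun F"
  using assms by (simp add: has_gen_fun_def)

lemma has_gen_funD:
  assumes "a has_gen_fun F" "norm q < 1" "q \<noteq> 0"
  shows "(\<lambda>n. a n * q ^ n) sums F q"
  using assms by (simp add: has_gen_fun_def)

lemma power_series_even_part_sums:
  fixes a :: "nat \<Rightarrow> 'a :: real_normed_field"
  assumes "(\<lambda>n. a n * p ^ n) sums s" "(\<lambda>n. a n * (- p) ^ n) sums t"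
  shows "(\<lambda>n. a (2 * n) * (p\<^sup>2) ^ n) sums ((s + t) / 2)"
proof -
  have "(\<lambda>n. (a n * p ^ n + a n * (- p) ^ n) / 2) sums ((s + t) / 2)"
    by (intro sums_divide sums_add assms)
  also have "?this \<longleftrightarrow>
      (\<lambda>n. (a (2 * n) * p ^ (2 * n) + a (2 * n) * (- p) ^ (2 * n)) / 2) sums ((s + t) / 2)"
  proof (rule sums_mono_reindex[symmetric])
    fix n :: nat assume "n \<notin> range (\<lambda>n. 2 * n)"
    then have "odd n"
      by (metis evenE rangeI)
    then show "(a n * p ^ n + a n * (- p) ^ n) / 2 = 0"
      by simp
  qed (simp add: strict_mono_def)
  finally show ?thesis
    by (simp add: power_mult)
qed

lemma power_series_odd_part_sums:
  fixes a :: "nat \<Rightarrow> 'a :: real_normed_field"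
  assumes "(\<lambda>n. a n * p ^ n) sums s" "(\<lambda>n. a n * (- p) ^ n) sums t" "p \<noteq> 0"
  shows "(\<lambda>n. a (2 * n + 1) * (p\<^sup>2) ^ n) sums ((s - t) / (2 * p))"
proof -
  have "(\<lambda>n. (a n * p ^ n - a n * (- p) ^ n) / (2 * p)) sums ((s - t) / (2 * p))"
    by (intro sums_divide sums_diff assms)
  also have "?this \<longleftrightarrow>
      (\<lambda>n. (a (2 * n + 1) * p ^ (2 * n + 1) - a (2 * n + 1) * (- p) ^ (2 * n + 1)) / (2 * p)) sums ((s - t) / (2 * p))"
  proof (rule sums_mono_reindex[symmetric])
    fix n :: nat assume "n \<notin> range (\<lambda>n. 2 * n + 1)"
    then have "even n"
      by (metis oddE rangeI)
    then show "(a n * p ^ n - a n * (- p) ^ n) / (2 * p) = 0"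
      by simp
  qed (simp add: strict_mono_def)
  finally show ?thesis
    using assms(3) by (simp add: power_mult mult.commute[of "a _"])
qed

lemma has_gen_fun_bisection:
  assumes gen_fun: "a has_gen_fun F"
    and split: "\<And>q. norm q < 1 \<Longrightarrow> q \<noteq> 0 \<Longrightarrow> F q = Fe (q\<^sup>2) + q * Fo (q\<^sup>2)"
  shows "(\<lambda>n. a (2 * n)) has_gen_fun Fe" and "(\<lambda>n. a (2 * n + 1)) has_gen_fun Fo"
proof -
  have parts: "(\<lambda>n. a (2 * n) * q ^ n) sums Fe q" "(\<lambda>n. a (2 * n + 1) * q ^ n) sums Fo q"
    if q: "norm q < 1" "q \<noteq> 0" for q
  proof -
    define p where "p = csqrt q"
    have p: "p\<^sup>2 = q" "norm p < 1" "p \<noteq> 0"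
      using q by (auto simp: p_def)
    have "(\<lambda>n. a n * p ^ n) sums (Fe q + p * Fo q)" "(\<lambda>n. a n * (- p) ^ n) sums (Fe q - p * Fo q)"
      using has_gen_funD[OF gen_fun, of p] has_gen_funD[OF gen_fun, of "- p"] split[of p] split[of "- p"] p by simp_all
    from power_series_even_part_sums[OF this] power_series_odd_part_sums[OF this p(3)]
    show "(\<lambda>n. a (2 * n) * q ^ n) sums Fe q" "(\<lambda>n. a (2 * n + 1) * q ^ n) sums Fo q"
      using p by simp_all
  qed
  show "(\<lambda>n. a (2 * n)) has_gen_fun Fe" "(\<lambda>n. a (2 * n + 1)) has_gen_fun Fo"
    by (intro has_gen_funI parts; assumption)+
qed

section \<open>Dissections of quotients of the J\<close>

lemma J_square_base:
  "J 1 (q\<^sup>2) = J 2 q" "J 2 (q\<^sup>2) = J 4 q" "J 4 (q\<^sup>2) = J 8 q" "J 8 (q\<^sup>2) = J 16 q"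
  "J 16 (q\<^sup>2) = J 32 q" "J 32 (q\<^sup>2) = J 64 q"
  by (simp_all add: J_power)

lemma theta_phi_explicit_bisection:
  assumes "norm q < 1" "q \<noteq> 0"
  shows "theta_phi q = J 8 q ^ 5 / (J 4 q ^ 2 * J 16 q ^ 2) + 2 * q * (J 16 q ^ 2 / J 8 q)"
  unfolding theta_phi_bisection[OF assms] theta_phi_power theta_psi_power by simp

lemma divide_J_1_square:
  assumes "norm q < 1" "q \<noteq> 0"
  shows "a / (J 1 q ^ 2 * b) = a * J 8 q ^ 5 / (J 2 q ^ 5 * J 16 q ^ 2 * b)
    + q * (2 * (a * J 4 q ^ 2 * J 16 q ^ 2 / (J 2 q ^ 5 * J 8 q * b)))"
proof -
  have "a / (J 1 q ^ 2 * b) = a * J 4 q ^ 2 / (J 2 q ^ 5 * b) * theta_phi q"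
    using assms by (simp add: theta_phi_def)
  also have "\<dots> = a * J 8 q ^ 5 / (J 2 q ^ 5 * J 16 q ^ 2 * b)
      + q * (2 * (a * J 4 q ^ 2 * J 16 q ^ 2 / (J 2 q ^ 5 * J 8 q * b)))"
    unfolding theta_phi_explicit_bisection[OF assms]
    using assms by (simp add: distrib_left add_divide_distrib power_numeral_reduce mult_ac)
  finally show ?thesis .
qed

lemma divide_J_1_fourth:
  assumes "norm q < 1" "q \<noteq> 0"
  shows "a / (J 1 q ^ 4 * b) = a * J 4 q ^ 14 / (J 2 q ^ 14 * J 8 q ^ 4 * b)
    + q * (4 * (a * J 4 q ^ 2 * J 8 q ^ 4 / (J 2 q ^ 10 * b)))"
proof -
  have "a / (J 1 q ^ 4 * b) = a * J 4 q ^ 4 / (J 2 q ^ 10 * b) * theta_phi q ^ 2"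
    using assms by (simp add: theta_phi_def power_divide power_mult_distrib flip: power_mult)
  also have "\<dots> = a * J 4 q ^ 14 / (J 2 q ^ 14 * J 8 q ^ 4 * b)
      + q * (4 * (a * J 4 q ^ 2 * J 8 q ^ 4 / (J 2 q ^ 10 * b)))"
    unfolding theta_phi_square[OF assms] theta_phi_power theta_psi_power
    using assms by (simp add: distrib_left add_divide_distrib power_numeral_reduce mult_ac)
  finally show ?thesis .
qed

lemma divide_J_1_eighth:
  assumes "norm q < 1" "q \<noteq> 0"
  shows "a / (J 1 q ^ 8 * b) = a * J 4 q ^ 28 / (J 2 q ^ 28 * J 8 q ^ 8 * b)
    + q\<^sup>2 * (16 * (a * J 4 q ^ 4 * J 8 q ^ 8 / (J 2 q ^ 20 * b))) + q * (8 * (a * J 4 q ^ 16 / (J 2 q ^ 24 * b)))"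
proof -
  have "a / (J 1 q ^ 8 * b) = a / b * (1 / (J 1 q ^ 4 * 1))\<^sup>2"
    by (simp add: power_divide flip: power_mult)
  also have "\<dots> = a * J 4 q ^ 28 / (J 2 q ^ 28 * J 8 q ^ 8 * b)
    + q\<^sup>2 * (16 * (a * J 4 q ^ 4 * J 8 q ^ 8 / (J 2 q ^ 20 * b))) + q * (8 * (a * J 4 q ^ 16 / (J 2 q ^ 24 * b)))"
    unfolding divide_J_1_fourth[OF assms] power2_sum
    using assms by (simp add: distrib_left add_divide_distrib power_numeral_reduce mult_ac)
  finally show ?thesis .
qed

lemma half_sum_diff_J_quotients:
  assumes "norm q < 1" "q \<noteq> 0"
  shows "1 / 2 * (J 2 q ^ 9 / (J 1 q ^ 6 * J 4 q ^ 2) + J 2 q ^ 3 / J 1 q ^ 2) =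
      J 2 q ^ 4 * J 8 q ^ 5 / (J 1 q ^ 4 * J 4 q ^ 2 * J 16 q ^ 2)"
    and "1 / 2 * (J 2 q ^ 9 / (J 1 q ^ 6 * J 4 q ^ 2) - J 2 q ^ 3 / J 1 q ^ 2) =
      2 * q * (J 2 q ^ 4 * J 16 q ^ 2 / (J 1 q ^ 4 * J 8 q))"
proof -
  have J_eq_phi: "J 2 q ^ 9 / (J 1 q ^ 6 * J 4 q ^ 2) = J 2 q ^ 4 / J 1 q ^ 4 * theta_phi q"
    "J 2 q ^ 3 / J 1 q ^ 2 = J 2 q ^ 4 / J 1 q ^ 4 * theta_phi (- q)"
    unfolding theta_phi_minus[OF assms(1)] using assms
    by (simp_all add: theta_phi_def power_numeral_reduce mult_ac)
  have "theta_phi (- q) = J 8 q ^ 5 / (J 4 q ^ 2 * J 16 q ^ 2) - 2 * q * (J 16 q ^ 2 / J 8 q)"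
    using theta_phi_explicit_bisection[of "- q"] assms by (simp add: J_minus_even)
  then show "1 / 2 * (J 2 q ^ 9 / (J 1 q ^ 6 * J 4 q ^ 2) + J 2 q ^ 3 / J 1 q ^ 2) =
      J 2 q ^ 4 * J 8 q ^ 5 / (J 1 q ^ 4 * J 4 q ^ 2 * J 16 q ^ 2)"
    "1 / 2 * (J 2 q ^ 9 / (J 1 q ^ 6 * J 4 q ^ 2) - J 2 q ^ 3 / J 1 q ^ 2) =
      2 * q * (J 2 q ^ 4 * J 16 q ^ 2 / (J 1 q ^ 4 * J 8 q))"
    unfolding J_eq_phi theta_phi_explicit_bisection[OF assms]
    by (simp_all add: distrib_left right_diff_distrib mult_ac)
qed

section \<open>The rank modulo 4 in arithmetic progressions\<close>

lemma sum_fourth_roots_unity: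
  fixes f :: "complex \<Rightarrow> 'a :: comm_monoid_add"
  shows "(\<Sum>z | z ^ 4 = 1. f z) = f 1 + (f (- 1) + (f \<i> + f (- \<i>)))"
proof -
  have distinct: "(1 :: complex) \<noteq> - 1" "1 \<noteq> \<i>" "1 \<noteq> - \<i>" "- 1 \<noteq> \<i>" "- 1 \<noteq> - \<i>" "\<i> \<noteq> - \<i>"
    by (simp_all add: complex_eq_iff)
  show ?thesis
    unfolding complex_fourth_roots_unity
    by (simp only: sum.insert sum.empty finite.intros insert_iff empty_iff distinct simp_thms add_0_right)
qed

lemma N0_mod_4_sums:
  assumes q: "norm q < 1" "q \<noteq> 0"
  shows "(\<lambda>n. of_nat (N0 0 4 n) * q ^ n) sums (q * ((omega_even (q\<^sup>2) + g (\<i> * q) (q\<^sup>2)) / 2))"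
    and "(\<lambda>n. of_nat (N0 1 4 n) * q ^ n) sums (omega_odd (q\<^sup>2) / 2)"
    and "(\<lambda>n. of_nat (N0 2 4 n) * q ^ n) sums (q * ((omega_even (q\<^sup>2) - g (\<i> * q) (q\<^sup>2)) / 2))"
proof -
  have g_values: "q * g (1 * q) (q\<^sup>2) = omega_odd (q\<^sup>2) + q * omega_even (q\<^sup>2)"
    "q * g (- 1 * q) (q\<^sup>2) = - omega_odd (q\<^sup>2) + q * omega_even (q\<^sup>2)"
    "q * g (- \<i> * q) (q\<^sup>2) = q * g (\<i> * q) (q\<^sup>2)"
    using omega_bisection[OF q] omega_minus_bisection[OF q] g_imaginary(2)[OF q] q
    by (simp_all add: distrib_left right_diff_distrib)
  note sums = N0_gen_fun[OF q, of 4, unfolded sum_fourth_roots_unity g_values, simplified]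
  note distribs = add_divide_distrib diff_divide_distrib distrib_left right_diff_distrib
  show "(\<lambda>n. of_nat (N0 0 4 n) * q ^ n) sums (q * ((omega_even (q\<^sup>2) + g (\<i> * q) (q\<^sup>2)) / 2))"
    using sums[of 0] by (simp add: distribs)
  show "(\<lambda>n. of_nat (N0 1 4 n) * q ^ n) sums (omega_odd (q\<^sup>2) / 2)"
    using sums[of 1] by (simp add: distribs)
  show "(\<lambda>n. of_nat (N0 2 4 n) * q ^ n) sums (q * ((omega_even (q\<^sup>2) - g (\<i> * q) (q\<^sup>2)) / 2))"
    using sums[of 2] by (simp add: power_int_minus distribs)
qed

lemma omega_even_add_diff_g_imaginary:
  assumes q: "norm q < 1" "q \<noteq> 0"
  shows "omega_even (q\<^sup>2) + g (\<i> * q) (q\<^sup>2) =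
      - (2 * q\<^sup>2 * omega_even (q ^ 8)) + J 4 q ^ 8 * J 16 q ^ 2 / (J 2 q ^ 4 * J 8 q ^ 5) + J 8 q ^ 3 / J 4 q ^ 2"
    and "omega_even (q\<^sup>2) - g (\<i> * q) (q\<^sup>2) =
      2 * omega_odd (q ^ 8) / q\<^sup>2 + J 4 q ^ 8 * J 16 q ^ 2 / (J 2 q ^ 4 * J 8 q ^ 5) - J 8 q ^ 3 / J 4 q ^ 2"
proof -
  have q4: "norm (q ^ 4) < 1" "q ^ 4 \<noteq> 0"
    using norm_power_less_1[OF q(1)] q by auto
  have "g (q ^ 4) (q ^ 8) = omega_odd (q ^ 8) / q ^ 4 + omega_even (q ^ 8)"
    "g (- (q ^ 4)) (q ^ 8) = - omega_odd (q ^ 8) / q ^ 4 + omega_even (q ^ 8)"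
    using omega_bisection[OF q4] omega_minus_bisection[OF q4] by (simp_all flip: power_mult)
  moreover have "q\<^sup>2 * (c / q ^ 4) = c / q\<^sup>2" for c
    using q by (simp add: power_numeral_reduce)
  ultimately have omega: "q\<^sup>2 * g (q ^ 4) (q ^ 8) = omega_odd (q ^ 8) / q\<^sup>2 + q\<^sup>2 * omega_even (q ^ 8)"
    "q\<^sup>2 * g (- (q ^ 4)) (q ^ 8) = - omega_odd (q ^ 8) / q\<^sup>2 + q\<^sup>2 * omega_even (q ^ 8)"
    by (simp_all only: distrib_left)
  have even: "omega_even (q\<^sup>2) = - (q\<^sup>2 * g (- (q ^ 4)) (q ^ 8)) + J 4 q ^ 8 * J 16 q ^ 2 / (J 2 q ^ 4 * J 8 q ^ 5)"
    by (simp add: omega_even_def J_power flip: power_mult)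
  show "omega_even (q\<^sup>2) + g (\<i> * q) (q\<^sup>2) =
      - (2 * q\<^sup>2 * omega_even (q ^ 8)) + J 4 q ^ 8 * J 16 q ^ 2 / (J 2 q ^ 4 * J 8 q ^ 5) + J 8 q ^ 3 / J 4 q ^ 2"
    "omega_even (q\<^sup>2) - g (\<i> * q) (q\<^sup>2) =
      2 * omega_odd (q ^ 8) / q\<^sup>2 + J 4 q ^ 8 * J 16 q ^ 2 / (J 2 q ^ 4 * J 8 q ^ 5) - J 8 q ^ 3 / J 4 q ^ 2"
    unfolding even g_imaginary(1)[OF q] omega by simp_all
qed

lemma N0_0_gen_fun_odd:
  "(\<lambda>n. of_nat (N0 0 4 (2 * n + 1))) has_gen_fun
    (\<lambda>q. q ^ 5 * g (- (q ^ 8)) (q ^ 16) - q * (J 8 q ^ 8 * J 32 q ^ 2 / (J 4 q ^ 4 * J 16 q ^ 5))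
      + 1 / 2 * ((J 2 q ^ 8 * J 8 q ^ 2 / (J 1 q ^ 4 * J 4 q ^ 5)) + (J 4 q ^ 3 / J 2 q ^ 2)))" (is "_ has_gen_fun ?O")
proof (rule has_gen_fun_bisection(2)[where Fe = "\<lambda>_. 0", OF has_gen_funI[OF N0_mod_4_sums(1)]])
  fix q :: complex assume q: "norm q < 1" "q \<noteq> 0"
  show "q * ((omega_even (q\<^sup>2) + g (\<i> * q) (q\<^sup>2)) / 2) = 0 + q * ?O (q\<^sup>2)"
    unfolding omega_even_add_diff_g_imaginary(1)[OF q] unfolding omega_even_def J_square_base
    by (simp add: J_power add_divide_distrib diff_divide_distrib algebra_simps flip: power_mult power_add)
qed

lemma N0_1_gen_fun_even:
  "(\<lambda>n. of_nat (N0 1 4 (2 * n))) has_gen_fun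
    (\<lambda>q. - (1 / 2) + 1 / 2 * g (- 1) (q ^ 4) + 1 / 4 * (J 2 q ^ 6 * J 4 q / (J 1 q ^ 4 * J 8 q ^ 2)))"
proof (rule has_gen_fun_bisection(1)[where Fo = "\<lambda>_. 0", OF has_gen_funI[OF N0_mod_4_sums(2)]])
qed (simp_all add: omega_odd_def add_divide_distrib diff_divide_distrib)

lemma N0_2_gen_fun_odd:
  "(\<lambda>n. of_nat (N0 2 4 (2 * n + 1))) has_gen_fun
    (\<lambda>q. - inverse q + inverse q * g (- 1) (q ^ 16)
      + 1 / 2 * inverse q * (J 8 q ^ 6 * J 16 q / (J 4 q ^ 4 * J 32 q ^ 2))
      - 1 / 2 * (J 4 q ^ 3 / J 2 q ^ 2) + 1 / 2 * (J 2 q ^ 8 * J 8 q ^ 2 / (J 1 q ^ 4 * J 4 q ^ 5)))"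
    (is "_ has_gen_fun ?O")
proof (rule has_gen_fun_bisection(2)[where Fe = "\<lambda>_. 0", OF has_gen_funI[OF N0_mod_4_sums(3)]])
  fix q :: complex assume q: "norm q < 1" "q \<noteq> 0"
  have "omega_odd (q ^ 8) =
      - 1 + g (- 1) (q ^ 32) + 1 / 2 * (J 16 q ^ 6 * J 32 q / (J 8 q ^ 4 * J 64 q ^ 2))"
    by (simp add: omega_odd_def J_power flip: power_mult)
  then show "q * ((omega_even (q\<^sup>2) - g (\<i> * q) (q\<^sup>2)) / 2) = 0 + q * ?O (q\<^sup>2)"
    unfolding omega_even_add_diff_g_imaginary(2)[OF q] J_square_base
    by (simp add: inverse_eq_divide add_divide_distrib diff_divide_distrib mult_ac flip: power_mult)
qed

lemma N0_0_gen_fun_mod_4_1_3: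
  shows "(\<lambda>n. of_nat (N0 0 4 (4 * n + 1))) has_gen_fun
      (\<lambda>q. J 2 q ^ 4 * J 8 q ^ 5 / (J 1 q ^ 4 * J 4 q ^ 2 * J 16 q ^ 2))" (is "_ has_gen_fun ?E")
    and "(\<lambda>n. of_nat (N0 0 4 (4 * n + 3))) has_gen_fun
      (\<lambda>q. q ^ 2 * g (- (q ^ 4)) (q ^ 8) - (J 4 q ^ 8 * J 16 q ^ 2 / (J 2 q ^ 4 * J 8 q ^ 5))
        + 2 * (J 4 q ^ 6 / (J 1 q ^ 2 * J 2 q ^ 3)))" (is "_ has_gen_fun ?O")
proof -
  have split: "q ^ 5 * g (- (q ^ 8)) (q ^ 16) - q * (J 8 q ^ 8 * J 32 q ^ 2 / (J 4 q ^ 4 * J 16 q ^ 5))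
        + 1 / 2 * ((J 2 q ^ 8 * J 8 q ^ 2 / (J 1 q ^ 4 * J 4 q ^ 5)) + (J 4 q ^ 3 / J 2 q ^ 2)) =
      ?E (q\<^sup>2) + q * ?O (q\<^sup>2)"
    if q: "norm q < 1" "q \<noteq> 0" for q
  proof -
    have q2: "norm (q\<^sup>2) < 1" "q\<^sup>2 \<noteq> 0"
      using norm_power_less_1[OF q(1)] q by auto
    show ?thesis
      using half_sum_diff_J_quotients(1)[OF q2, symmetric] q
      unfolding mult.assoc divide_J_1_fourth[OF q] J_square_base
      by (simp add: power_numeral_reduce distrib_left right_diff_distrib mult_ac)
  qed
  from has_gen_fun_bisection[OF N0_0_gen_fun_odd, of ?E ?O, OF split]
  show "(\<lambda>n. of_nat (N0 0 4 (4 * n + 1))) has_gen_fun ?E" "(\<lambda>n. of_nat (N0 0 4 (4 * n + 3))) has_gen_fun ?O"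
    by (simp_all add: add.commute numeral_3_eq_3)
qed

lemma N0_0_gen_fun_mod_8_1_5:
  shows "(\<lambda>n. of_nat (N0 0 4 (8 * n + 1))) has_gen_fun
      (\<lambda>q. J 2 q ^ 12 * J 4 q / (J 1 q ^ 10 * J 8 q ^ 2))" (is "_ has_gen_fun ?E")
    and "(\<lambda>n. of_nat (N0 0 4 (8 * n + 5))) has_gen_fun
      (\<lambda>q. 4 * (J 4 q ^ 9 / (J 1 q ^ 6 * J 8 q ^ 2)))" (is "_ has_gen_fun ?O")
proof -
  have split: "J 2 q ^ 4 * J 8 q ^ 5 / (J 1 q ^ 4 * J 4 q ^ 2 * J 16 q ^ 2) =
      ?E (q\<^sup>2) + q * ?O (q\<^sup>2)"
    if q: "norm q < 1" "q \<noteq> 0" for q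
    unfolding mult.assoc divide_J_1_fourth[OF q] J_square_base using q
    by (simp add: power_numeral_reduce mult_ac)
  from has_gen_fun_bisection[OF N0_0_gen_fun_mod_4_1_3(1), of ?E ?O, OF split]
  show "(\<lambda>n. of_nat (N0 0 4 (8 * n + 1))) has_gen_fun ?E" "(\<lambda>n. of_nat (N0 0 4 (8 * n + 5))) has_gen_fun ?O"
    by (simp_all add: add.commute)
qed

lemma N0_0_gen_fun_mod_8_3_7:
  shows "(\<lambda>n. of_nat (N0 0 4 (8 * n + 3))) has_gen_fun
      (\<lambda>q. q * g (- (q ^ 2)) (q ^ 4) + 2 * (J 2 q ^ 6 * J 4 q ^ 5 / (J 1 q ^ 8 * J 8 q ^ 2))
        - (J 2 q ^ 8 * J 8 q ^ 2 / (J 1 q ^ 4 * J 4 q ^ 5)))" (is "_ has_gen_fun ?E")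
    and "(\<lambda>n. of_nat (N0 0 4 (8 * n + 7))) has_gen_fun
      (\<lambda>q. 4 * (J 2 q ^ 8 * J 8 q ^ 2 / (J 1 q ^ 8 * J 4 q)))" (is "_ has_gen_fun ?O")
proof -
  have split: "q ^ 2 * g (- (q ^ 4)) (q ^ 8) - (J 4 q ^ 8 * J 16 q ^ 2 / (J 2 q ^ 4 * J 8 q ^ 5))
        + 2 * (J 4 q ^ 6 / (J 1 q ^ 2 * J 2 q ^ 3)) =
      ?E (q\<^sup>2) + q * ?O (q\<^sup>2)"
    if q: "norm q < 1" "q \<noteq> 0" for q
    unfolding mult.assoc divide_J_1_square[OF q] J_square_base using q
    by (simp add: power_numeral_reduce mult_ac)
  from has_gen_fun_bisection[OF N0_0_gen_fun_mod_4_1_3(2), of ?E ?O, OF split]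
  show "(\<lambda>n. of_nat (N0 0 4 (8 * n + 3))) has_gen_fun ?E" "(\<lambda>n. of_nat (N0 0 4 (8 * n + 7))) has_gen_fun ?O"
    by (simp_all add: add.commute)
qed

lemma N0_1_gen_fun_mod_4_0_2:
  shows "(\<lambda>n. of_nat (N0 1 4 (4 * n))) has_gen_fun
      (\<lambda>q. - (1 / 2) + 1 / 2 * g (- 1) (q ^ 2) + 1 / 4 * (J 2 q ^ 15 / (J 1 q ^ 8 * J 4 q ^ 6)))"
      (is "_ has_gen_fun ?E")
    and "(\<lambda>n. of_nat (N0 1 4 (4 * n + 2))) has_gen_fun
      (\<lambda>q. J 2 q ^ 3 * J 4 q ^ 2 / J 1 q ^ 4)" (is "_ has_gen_fun ?O")
proof -
  have split: "- (1 / 2) + 1 / 2 * g (- 1) (q ^ 4) + 1 / 4 * (J 2 q ^ 6 * J 4 q / (J 1 q ^ 4 * J 8 q ^ 2)) =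
      ?E (q\<^sup>2) + q * ?O (q\<^sup>2)"
    if q: "norm q < 1" "q \<noteq> 0" for q
    unfolding mult.assoc divide_J_1_fourth[OF q] J_square_base using q
    by (simp add: power_numeral_reduce mult_ac)
  from has_gen_fun_bisection[OF N0_1_gen_fun_even, of ?E ?O, OF split]
  show "(\<lambda>n. of_nat (N0 1 4 (4 * n))) has_gen_fun ?E" "(\<lambda>n. of_nat (N0 1 4 (4 * n + 2))) has_gen_fun ?O"
    by (simp_all add: add.commute)
qed

lemma N0_1_gen_fun_mod_8_0_4:
  shows "(\<lambda>n. of_nat (N0 1 4 (8 * n))) has_gen_fun
      (\<lambda>q. - (1 / 2) + 1 / 2 * g (- 1) q + 1 / 4 * (J 2 q ^ 22 / (J 1 q ^ 13 * J 4 q ^ 8))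
        + 4 * q * (J 4 q ^ 8 / (J 1 q ^ 5 * J 2 q ^ 2)))" (is "_ has_gen_fun ?E")
    and "(\<lambda>n. of_nat (N0 1 4 (8 * n + 4))) has_gen_fun
      (\<lambda>q. 2 * (J 2 q ^ 10 / J 1 q ^ 9))" (is "_ has_gen_fun ?O")
proof -
  have split: "- (1 / 2) + 1 / 2 * g (- 1) (q ^ 2) + 1 / 4 * (J 2 q ^ 15 / (J 1 q ^ 8 * J 4 q ^ 6)) =
      ?E (q\<^sup>2) + q * ?O (q\<^sup>2)"
    if q: "norm q < 1" "q \<noteq> 0" for q
    unfolding mult.assoc divide_J_1_eighth[OF q] J_square_base using q
    by (simp add: power_numeral_reduce mult_ac)
  from has_gen_fun_bisection[OF N0_1_gen_fun_mod_4_0_2(1), of ?E ?O, OF split]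
  show "(\<lambda>n. of_nat (N0 1 4 (8 * n))) has_gen_fun ?E" "(\<lambda>n. of_nat (N0 1 4 (8 * n + 4))) has_gen_fun ?O"
    by (simp_all add: add.commute)
qed

lemma N0_1_gen_fun_mod_8_2_6:
  shows "(\<lambda>n. of_nat (N0 1 4 (8 * n + 2))) has_gen_fun
      (\<lambda>q. J 2 q ^ 16 / (J 1 q ^ 11 * J 4 q ^ 4))" (is "_ has_gen_fun ?E")
    and "(\<lambda>n. of_nat (N0 1 4 (8 * n + 6))) has_gen_fun
      (\<lambda>q. 4 * (J 2 q ^ 4 * J 4 q ^ 4 / J 1 q ^ 7))" (is "_ has_gen_fun ?O")
proof -
  have split: "J 2 q ^ 3 * J 4 q ^ 2 / J 1 q ^ 4 =
      ?E (q\<^sup>2) + q * ?O (q\<^sup>2)"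
    if q: "norm q < 1" "q \<noteq> 0" for q
    unfolding mult.assoc J_square_base using q divide_J_1_fourth[OF q, of _ 1]
    by (simp add: power_numeral_reduce mult_ac)
  from has_gen_fun_bisection[OF N0_1_gen_fun_mod_4_0_2(2), of ?E ?O, OF split]
  show "(\<lambda>n. of_nat (N0 1 4 (8 * n + 2))) has_gen_fun ?E" "(\<lambda>n. of_nat (N0 1 4 (8 * n + 6))) has_gen_fun ?O"
    by (simp_all add: add.commute)
qed

lemma N0_2_gen_fun_mod_4_1_3:
  shows "(\<lambda>n. of_nat (N0 2 4 (4 * n + 1))) has_gen_fun
      (\<lambda>q. 2 * q * (J 2 q ^ 4 * J 16 q ^ 2 / (J 1 q ^ 4 * J 8 q)))" (is "_ has_gen_fun ?E")
    and "(\<lambda>n. of_nat (N0 2 4 (4 * n + 3))) has_gen_fun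
      (\<lambda>q. - inverse q + inverse q * g (- 1) (q ^ 8)
        + 1 / 2 * inverse q * (J 4 q ^ 6 * J 8 q / (J 2 q ^ 4 * J 16 q ^ 2))
        + 2 * (J 4 q ^ 6 / (J 1 q ^ 2 * J 2 q ^ 3)))" (is "_ has_gen_fun ?O")
proof -
  have split: "- inverse q + inverse q * g (- 1) (q ^ 16)
        + 1 / 2 * inverse q * (J 8 q ^ 6 * J 16 q / (J 4 q ^ 4 * J 32 q ^ 2))
        - 1 / 2 * (J 4 q ^ 3 / J 2 q ^ 2) + 1 / 2 * (J 2 q ^ 8 * J 8 q ^ 2 / (J 1 q ^ 4 * J 4 q ^ 5)) =
      ?E (q\<^sup>2) + q * ?O (q\<^sup>2)"
    if q: "norm q < 1" "q \<noteq> 0" for q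
  proof -
    have q2: "norm (q\<^sup>2) < 1" "q\<^sup>2 \<noteq> 0"
      using norm_power_less_1[OF q(1)] q by auto
    have cancel: "q * (inverse q * c) = c" for c
      using q by simp
    show ?thesis
      using half_sum_diff_J_quotients(2)[OF q2, symmetric] q
      unfolding mult.assoc divide_J_1_fourth[OF q] J_square_base
      by (simp add: cancel power_numeral_reduce distrib_left right_diff_distrib mult_ac)
  qed
  from has_gen_fun_bisection[OF N0_2_gen_fun_odd, of ?E ?O, OF split]
  show "(\<lambda>n. of_nat (N0 2 4 (4 * n + 1))) has_gen_fun ?E" "(\<lambda>n. of_nat (N0 2 4 (4 * n + 3))) has_gen_fun ?O"
    by (simp_all add: add.commute numeral_3_eq_3)
qed

lemma N0_2_gen_fun_mod_8_1_5:
  shows "(\<lambda>n. of_nat (N0 2 4 (8 * n + 1))) has_gen_fun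
      (\<lambda>q. 8 * q * (J 2 q ^ 2 * J 4 q ^ 3 * J 8 q ^ 2 / J 1 q ^ 6))" (is "_ has_gen_fun ?E")
    and "(\<lambda>n. of_nat (N0 2 4 (8 * n + 5))) has_gen_fun
      (\<lambda>q. 2 * (J 2 q ^ 14 * J 8 q ^ 2 / (J 1 q ^ 10 * J 4 q ^ 5)))" (is "_ has_gen_fun ?O")
proof -
  have split: "2 * q * (J 2 q ^ 4 * J 16 q ^ 2 / (J 1 q ^ 4 * J 8 q)) =
      ?E (q\<^sup>2) + q * ?O (q\<^sup>2)"
    if q: "norm q < 1" "q \<noteq> 0" for q
    unfolding mult.assoc divide_J_1_fourth[OF q] J_square_base using q
    by (simp add: power_numeral_reduce distrib_left mult_ac)
  from has_gen_fun_bisection[OF N0_2_gen_fun_mod_4_1_3(1), of ?E ?O, OF split]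
  show "(\<lambda>n. of_nat (N0 2 4 (8 * n + 1))) has_gen_fun ?E" "(\<lambda>n. of_nat (N0 2 4 (8 * n + 5))) has_gen_fun ?O"
    by (simp_all add: add.commute)
qed

lemma N0_2_gen_fun_mod_8_3_7:
  shows "(\<lambda>n. of_nat (N0 2 4 (8 * n + 3))) has_gen_fun
      (\<lambda>q. 2 * (J 2 q ^ 6 * J 4 q ^ 5 / (J 1 q ^ 8 * J 8 q ^ 2)))" (is "_ has_gen_fun ?E")
    and "(\<lambda>n. of_nat (N0 2 4 (8 * n + 7))) has_gen_fun
      (\<lambda>q. - inverse q + inverse q * g (- 1) (q ^ 4)
        + 1 / 2 * inverse q * (J 2 q ^ 6 * J 4 q / (J 1 q ^ 4 * J 8 q ^ 2))
        + 4 * (J 2 q ^ 8 * J 8 q ^ 2 / (J 1 q ^ 8 * J 4 q)))" (is "_ has_gen_fun ?O")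
proof -
  have split: "- inverse q + inverse q * g (- 1) (q ^ 8)
        + 1 / 2 * inverse q * (J 4 q ^ 6 * J 8 q / (J 2 q ^ 4 * J 16 q ^ 2))
        + 2 * (J 4 q ^ 6 / (J 1 q ^ 2 * J 2 q ^ 3)) =
      ?E (q\<^sup>2) + q * ?O (q\<^sup>2)"
    if q: "norm q < 1" "q \<noteq> 0" for q
  proof -
    have cancel: "q * (inverse q * c) = c" for c
      using q by simp
    show ?thesis
      unfolding mult.assoc divide_J_1_square[OF q] J_square_base using q
      by (simp add: cancel power_numeral_reduce distrib_left right_diff_distrib mult_ac)
  qed
  from has_gen_fun_bisection[OF N0_2_gen_fun_mod_4_1_3(2), of ?E ?O, OF split]
  show "(\<lambda>n. of_nat (N0 2 4 (8 * n + 3))) has_gen_fun ?E" "(\<lambda>n. of_nat (N0 2 4 (8 * n + 7))) has_gen_fun ?O"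
    by (simp_all add: add.commute)
qed

theorem theorem3p2:
  fixes q :: complex
  assumes "q \<noteq> 0" and "norm q < 1"
  shows
    "((\<lambda>n. of_nat (N0 0 4 (2 * n + 1)) * q ^ n) sums
        (q ^ 5 * g (- (q ^ 8)) (q ^ 16) - q * (J 8 q ^ 8 * J 32 q ^ 2 / (J 4 q ^ 4 * J 16 q ^ 5)) + 1 / 2 * ((J 2 q ^ 8 * J 8 q ^ 2 / (J 1 q ^ 4 * J 4 q ^ 5)) + (J 4 q ^ 3 / J 2 q ^ 2))) \<and>
      (\<lambda>n. of_nat (N0 0 4 (4 * n + 1)) * q ^ n) sums
        ((J 2 q ^ 4 * J 8 q ^ 5 / (J 1 q ^ 4 * J 4 q ^ 2 * J 16 q ^ 2))) \<and>
      (\<lambda>n. of_nat (N0 0 4 (4 * n + 3)) * q ^ n) sums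
        (q ^ 2 * g (- (q ^ 4)) (q ^ 8) - (J 4 q ^ 8 * J 16 q ^ 2 / (J 2 q ^ 4 * J 8 q ^ 5)) + 2 * (J 4 q ^ 6 / (J 1 q ^ 2 * J 2 q ^ 3))) \<and>
      (\<lambda>n. of_nat (N0 0 4 (8 * n + 1)) * q ^ n) sums
        ((J 2 q ^ 12 * J 4 q / (J 1 q ^ 10 * J 8 q ^ 2))) \<and>
      (\<lambda>n. of_nat (N0 0 4 (8 * n + 3)) * q ^ n) sums
        (q * g (- (q ^ 2)) (q ^ 4) + 2 * (J 2 q ^ 6 * J 4 q ^ 5 / (J 1 q ^ 8 * J 8 q ^ 2)) - (J 2 q ^ 8 * J 8 q ^ 2 / (J 1 q ^ 4 * J 4 q ^ 5))) \<and>
      (\<lambda>n. of_nat (N0 0 4 (8 * n + 5)) * q ^ n) sums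
        (4 * (J 4 q ^ 9 / (J 1 q ^ 6 * J 8 q ^ 2))) \<and>
      (\<lambda>n. of_nat (N0 0 4 (8 * n + 7)) * q ^ n) sums
        (4 * (J 2 q ^ 8 * J 8 q ^ 2 / (J 1 q ^ 8 * J 4 q)))) \<and>
     ((\<lambda>n. of_nat (N0 1 4 (2 * n)) * q ^ n) sums
        (- (1 / 2) + 1 / 2 * g (- 1) (q ^ 4) + 1 / 4 * (J 2 q ^ 6 * J 4 q / (J 1 q ^ 4 * J 8 q ^ 2))) \<and>
      (\<lambda>n. of_nat (N0 1 4 (4 * n)) * q ^ n) sums
        (- (1 / 2) + 1 / 2 * g (- 1) (q ^ 2) + 1 / 4 * (J 2 q ^ 15 / (J 1 q ^ 8 * J 4 q ^ 6))) \<and>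
      (\<lambda>n. of_nat (N0 1 4 (4 * n + 2)) * q ^ n) sums
        ((J 2 q ^ 3 * J 4 q ^ 2 / J 1 q ^ 4)) \<and>
      (\<lambda>n. of_nat (N0 1 4 (8 * n)) * q ^ n) sums
        (- (1 / 2) + 1 / 2 * g (- 1) q + 1 / 4 * (J 2 q ^ 22 / (J 1 q ^ 13 * J 4 q ^ 8)) + 4 * q * (J 4 q ^ 8 / (J 1 q ^ 5 * J 2 q ^ 2))) \<and>
      (\<lambda>n. of_nat (N0 1 4 (8 * n + 2)) * q ^ n) sums
        ((J 2 q ^ 16 / (J 1 q ^ 11 * J 4 q ^ 4))) \<and>
      (\<lambda>n. of_nat (N0 1 4 (8 * n + 4)) * q ^ n) sums
        (2 * (J 2 q ^ 10 / J 1 q ^ 9)) \<and>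
      (\<lambda>n. of_nat (N0 1 4 (8 * n + 6)) * q ^ n) sums
        (4 * (J 2 q ^ 4 * J 4 q ^ 4 / J 1 q ^ 7))) \<and>
     ((\<lambda>n. of_nat (N0 2 4 (2 * n + 1)) * q ^ n) sums
        (- inverse q + inverse q * g (- 1) (q ^ 16) + 1 / 2 * inverse q * (J 8 q ^ 6 * J 16 q / (J 4 q ^ 4 * J 32 q ^ 2)) - 1 / 2 * (J 4 q ^ 3 / J 2 q ^ 2) + 1 / 2 * (J 2 q ^ 8 * J 8 q ^ 2 / (J 1 q ^ 4 * J 4 q ^ 5))) \<and>
      (\<lambda>n. of_nat (N0 2 4 (4 * n + 1)) * q ^ n) sums
        (2 * q * (J 2 q ^ 4 * J 16 q ^ 2 / (J 1 q ^ 4 * J 8 q))) \<and>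
      (\<lambda>n. of_nat (N0 2 4 (4 * n + 3)) * q ^ n) sums
        (- inverse q + inverse q * g (- 1) (q ^ 8) + 1 / 2 * inverse q * (J 4 q ^ 6 * J 8 q / (J 2 q ^ 4 * J 16 q ^ 2)) + 2 * (J 4 q ^ 6 / (J 1 q ^ 2 * J 2 q ^ 3))) \<and>
      (\<lambda>n. of_nat (N0 2 4 (8 * n + 1)) * q ^ n) sums
        (8 * q * (J 2 q ^ 2 * J 4 q ^ 3 * J 8 q ^ 2 / J 1 q ^ 6)) \<and>
      (\<lambda>n. of_nat (N0 2 4 (8 * n + 3)) * q ^ n) sums
        (2 * (J 2 q ^ 6 * J 4 q ^ 5 / (J 1 q ^ 8 * J 8 q ^ 2))) \<and>
      (\<lambda>n. of_nat (N0 2 4 (8 * n + 5)) * q ^ n) sums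
        (2 * (J 2 q ^ 14 * J 8 q ^ 2 / (J 1 q ^ 10 * J 4 q ^ 5))) \<and>
      (\<lambda>n. of_nat (N0 2 4 (8 * n + 7)) * q ^ n) sums
        (- inverse q + inverse q * g (- 1) (q ^ 4) + 1 / 2 * inverse q * (J 2 q ^ 6 * J 4 q / (J 1 q ^ 4 * J 8 q ^ 2)) + 4 * (J 2 q ^ 8 * J 8 q ^ 2 / (J 1 q ^ 8 * J 4 q))))"
proof -
  note gen_funs = N0_0_gen_fun_odd N0_0_gen_fun_mod_4_1_3 N0_0_gen_fun_mod_8_1_5 N0_0_gen_fun_mod_8_3_7
    N0_1_gen_fun_even N0_1_gen_fun_mod_4_0_2 N0_1_gen_fun_mod_8_0_4 N0_1_gen_fun_mod_8_2_6
    N0_2_gen_fun_odd N0_2_gen_fun_mod_4_1_3 N0_2_gen_fun_mod_8_1_5 N0_2_gen_fun_mod_8_3_7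
  show ?thesis
    by (intro conjI gen_funs[THEN has_gen_funD, OF assms(2,1)])
qed

end
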